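(* Let $V\subset\mathbb{R}^n$ be a closed pointed convex cone. Then a pair $(A,B)\in\mathcal{P}_V^2(\mathbb{R}^n)$ is reduced if and only if $A$ and $B$ have no equiparallel edges.
   Context: A cone $V$ is pointed if $V\cap(-V)=\{0\}$. $\mathcal{C}_V(\mathbb{R}^n)$ is the family of all nonempty closed convex sets $A\subset\mathbb{R}^n$ whose recession cone $\{x\in\mathbb{R}^n\mid x+A\subset A\}$ equals $V$. $\mathcal{P}_V(\mathbb{R}^n)=\{P+V\mid P \text{ a nonempty polytope in }\mathbb{R}^n\}$ is the family of $V$-polytopes (Minkowski sums), and $\mathcal{P}_V^2(\mathbb{R}^n)=\mathcal{P}_V(\mathbb{R}^n)\times\mathcal{P}_V(\mathbb{R}^n)$, $\mathcal{C}_V^2(\mathbb{R}^n)=\mathcal{C}_V(\mathbb{R}^n)\times\mathcal{C}_V(\mathbb{R}^n)$. For a closed convex set $A$ and $u\in\mathbb{R}^n$, the support set is $A(u)=\{a\in A\mid\langle a,u\rangle=\max_{x\in A}\langle x,u\rangle\}$. Two bounded support sets $A(u)$ and $B(u)$ (same $u$) are equiparallel edges if they are parallel (nondegenerate) line segments; $A$ and $B$ have no equiparallel edges if this happens for no $u$. Pairs $(A,B),(C,D)\in\mathcal{C}_V^2(\mathbb{R}^n)$ are equivalent if $A+D=B+C$, and $[A,B]$ denotes the equivalence class of $(A,B)$ in $\mathcal{C}_V^2(\mathbb{R}^n)$. A pair $(A,B)\in\mathcal{C}_V^2(\mathbb{R}^n)$ is reduced if $[A,B]=\{(A+M,B+M)\mid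 M\in\mathcal{C}_V(\mathbb{R}^n)\}$. *)

theory Defs
  imports "HOL-Analysis.Analysis" "HOL-Library.Set_Algebras"
begin

definition pointed :: "'a::real_vector set \<Rightarrow> bool" where
  "pointed V \<longleftrightarrow> V \<inter> uminus ` V = {0}"

definition recession_cone :: "'a::real_vector set \<Rightarrow> 'a set" where
  "recession_cone A = {x. (+) x ` A \<subseteq> A}"

definition closed_convex_sets :: "'a::euclidean_space set \<Rightarrow> 'a set set" where
  "closed_convex_sets V = {A. A \<noteq> {} \<and> closed A \<and> convex A \<and> recession_cone A = V}"

text \<open>Throughout, \<open>+\<close> on sets is the Minkowski sum. The library's \<^const>\<open>polytope\<close>
  admits the empty set, which is excluded here.\<close>

definition V_polytopes :: "'a::euclidean_space set \<Rightarrow> 'a set set" where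
  "V_polytopes V = {P + V | P. polytope P \<and> P \<noteq> {}}"

text \<open>The support set is empty if the maximum is not attained; \<open>u = 0\<close> is allowed and
  gives \<open>A\<close> itself.\<close>

definition support_set :: "'a::euclidean_space set \<Rightarrow> 'a \<Rightarrow> 'a set" where
  "support_set A u = {a \<in> A. \<forall>x\<in>A. x \<bullet> u \<le> a \<bullet> u}"

definition parallel_segments :: "'a::real_vector set \<Rightarrow> 'a set \<Rightarrow> bool" where
  "parallel_segments S T \<longleftrightarrow>
     (\<exists>a b c d. a \<noteq> b \<and> c \<noteq> d \<and> S = closed_segment a b \<and> T = closed_segment c d \<and>
        (\<exists>t. d - c = t *\<^sub>R (b - a)))"

definition equiparallel_edges_at :: "'a::euclidean_space set \<Rightarrow> 'a set \<Rightarrow> 'a \<Rightarrow> bool" where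
  "equiparallel_edges_at A B u \<longleftrightarrow>
     bounded (support_set A u) \<and> bounded (support_set B u) \<and>
     parallel_segments (support_set A u) (support_set B u)"

definition no_equiparallel_edges :: "'a::euclidean_space set \<Rightarrow> 'a set \<Rightarrow> bool" where
  "no_equiparallel_edges A B \<longleftrightarrow> (\<nexists>u. equiparallel_edges_at A B u)"

definition pair_equiv ::
  "'a::euclidean_space set \<Rightarrow> (('a set \<times> 'a set) \<times> ('a set \<times> 'a set)) set" where
  "pair_equiv V = {((A, B), (C, D)) | A B C D.
     (A, B) \<in> closed_convex_sets V \<times> closed_convex_sets V \<and>
     (C, D) \<in> closed_convex_sets V \<times> closed_convex_sets V \<and>
     A + D = B + C}"

definition reduced_pair :: "'a::euclidean_space set \<Rightarrow> 'a set \<times> 'a set \<Rightarrow> bool" where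
  "reduced_pair V = (\<lambda>(A, B).
     (A, B) \<in> closed_convex_sets V \<times> closed_convex_sets V \<and>
     pair_equiv V `` {(A, B)} = {(A + M, B + M) | M. M \<in> closed_convex_sets V})"

end

theory Submission
  imports Defs
begin

text \<open>
  Write \<open>h K\<close> for the support function of \<open>K\<close>. All sets with recession cone \<open>V\<close> are
  determined by the values of their support functions on the interior of the polar cone of \<open>V\<close>,
  the strict polar (lemma \<open>separation\<close>). There these functions are finite, attained, convex and
  continuous, and additive in the set, so \<open>A + D = B + C\<close> means \<open>h C - h A = h D - h B\<close>. The
  pair \<open>(A, B)\<close> is reduced if and only if, for all such \<open>C\<close> and \<open>D\<close>, this common difference \<open>g\<close>
  is the support function of some \<open>M\<close>, that is, if and only if \<open>g\<close> is always convex.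

  For \<open>V\<close>-polytopes \<open>h A\<close> and \<open>h B\<close> are piecewise linear, and an edge of \<open>A\<close> is the same as a
  crease of \<open>h A\<close> along a piece of the hyperplane orthogonal to it. Off the creases of \<open>h A\<close> the
  function \<open>g = h C - h A\<close> is locally convex, off those of \<open>h B\<close> it is so because
  \<open>g = h D - h B\<close>. Without equiparallel edges the creases of \<open>h A\<close> and \<open>h B\<close> meet only in
  codimension two, which a generic segment avoids, so \<open>g\<close> is convex along generic segments
  (lemma \<open>subgradient_in_minkowski_difference\<close>) and therefore the support function of the
  Minkowski difference \<open>M\<close> of \<open>C\<close> and \<open>A\<close> (lemma \<open>common_summand_if_no_equiparallel_edges\<close>).

  Conversely, let \<open>A\<close> and \<open>B\<close> have parallel edges at \<open>u\<close>. Shortening both by the same length,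
  and moving the polytopes themselves down at \<open>u\<close> by a finite set of vectors, gives \<open>C\<close> and \<open>D\<close>
  with \<open>A + D = B + C\<close> (lemma \<open>exchange_subset\<close>). But \<open>C\<close> has a shorter edge at \<open>u\<close> than \<open>A\<close>, so
  \<open>A\<close> is not a summand of \<open>C\<close> (lemma \<open>not_summand_if_shorter_edge\<close>).
\<close>

section \<open>Recession directions\<close>

text \<open>The convex combinations \<open>(1 - r n) k + r n (s n)\<close> stay in \<open>K\<close> and tend to \<open>k + v\<close>.\<close>
lemma recession_cone_limit:
  fixes K :: "'a::real_normed_vector set"
  assumes K: "closed K" "convex K"
    and s: "\<And>n. s n \<in> K"
    and r: "r \<longlonglongrightarrow> 0" "\<And>n. 0 \<le> r n"
    and lim: "(\<lambda>n. r n *\<^sub>R s n) \<longlonglongrightarrow> v"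
  shows "v \<in> recession_cone K"
proof -
  have "v + k \<in> K" if "k \<in> K" for k
  proof -
    have "(\<lambda>n. (1 - r n) *\<^sub>R k + r n *\<^sub>R s n) \<longlonglongrightarrow> (1 - 0) *\<^sub>R k + v"
      by (intro tendsto_intros r lim)
    moreover have "\<forall>\<^sub>F n in sequentially. (1 - r n) *\<^sub>R k + r n *\<^sub>R s n \<in> K"
    proof -
      have "\<forall>\<^sub>F n in sequentially. r n < 1"
        using r(1) by (rule order_tendstoD) simp
      then show ?thesis
        by eventually_elim (use K(2) s r(2) that in \<open>auto intro!: convexD\<close>)
    qed
    ultimately have "(1 - 0) *\<^sub>R k + v \<in> K"
      using Lim_in_closed_set[OF K(1)] by (metis sequentially_bot)
    then show ?thesis by (simp add: add.commute)
  qed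
  then show ?thesis by (auto simp: recession_cone_def)
qed

lemma recession_cone_add_multiple:
  assumes "v \<in> recession_cone K" "k \<in> K"
  shows "k + real n *\<^sub>R v \<in> K"
proof (induction n)
  case (Suc n)
  then have "v + (k + real n *\<^sub>R v) \<in> K"
    using assms(1) by (auto simp: recession_cone_def)
  then show ?case by (simp add: algebra_simps)
qed (use assms in simp)

text \<open>A sequence in \<open>K\<close> that stays within bounded distance of the ray through \<open>v\<close>, rescaled by
  \<open>1 / n\<close>, tends to \<open>v\<close>.\<close>
lemma recession_cone_approx:
  fixes K :: "'a::real_normed_vector set"
  assumes K: "closed K" "convex K"
    and s: "\<And>n. s n \<in> K"
    and bdd: "\<And>n. norm (s n - real n *\<^sub>R v) \<le> b"
  shows "v \<in> recession_cone K"
proof (rule recession_cone_limit[OF K])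
  show "s (Suc n) \<in> K" for n by (rule s)
  show "(\<lambda>n. inverse (real (Suc n))) \<longlonglongrightarrow> 0"
    by (rule LIMSEQ_inverse_real_of_nat)
  have "(\<lambda>n. inverse (real (Suc n)) *\<^sub>R (s (Suc n) - real (Suc n) *\<^sub>R v)) \<longlonglongrightarrow> 0"
  proof (rule Lim_null_comparison)
    show "\<forall>\<^sub>F n in sequentially. norm (inverse (real (Suc n)) *\<^sub>R (s (Suc n) - real (Suc n) *\<^sub>R v)) \<le> inverse (real (Suc n)) * b"
      using bdd by (intro always_eventually allI) (simp only: norm_scaleR abs_inverse abs_of_nat
          mult_left_mono inverse_nonnegative_iff_nonnegative of_nat_0_le_iff)
    show "(\<lambda>n. inverse (real (Suc n)) * b) \<longlonglongrightarrow> 0"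
      using tendsto_mult[OF LIMSEQ_inverse_real_of_nat tendsto_const[of b]] by simp
  qed
  from tendsto_add[OF this tendsto_const[of v]]
  show "(\<lambda>n. inverse (real (Suc n)) *\<^sub>R s (Suc n)) \<longlonglongrightarrow> v"
    by (simp add: scaleR_diff_right del: of_nat_Suc)
qed simp

lemma closed_compact_plus:
  fixes P K :: "'a::euclidean_space set"
  assumes "compact P" "closed K"
  shows "closed (P + K)"
proof -
  have "P + K = (\<Union>x\<in>P. \<Union>y\<in>K. {x + y})" by (auto simp: set_plus_def)
  then show ?thesis using compact_closed_sums[OF assms] by simp
qed

section \<open>Closed convex sets over a pointed cone\<close>

text \<open>For a closed cone this is the interior of the polar cone. It consists of the functionals
  that attain their maximum on every closed convex set with recession cone \<open>V\<close>, and they do so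
  on bounded faces.\<close>
definition strict_polar :: "'a::euclidean_space set \<Rightarrow> 'a set" where
  "strict_polar V = {x. \<forall>v\<in>V. v \<noteq> 0 \<longrightarrow> v \<bullet> x < 0}"

locale pointed_closed_cone =
  fixes V :: "'a::euclidean_space set"
  assumes closed_V: "closed V" and convex_V: "convex V" and cone_V: "cone V"
      and pointed_V: "pointed V"
begin

lemma zero_in_V: "0 \<in> V"
  using pointed_V by (auto simp: pointed_def)

lemma scale_in_V: "v \<in> V \<Longrightarrow> 0 \<le> t \<Longrightarrow> t *\<^sub>R v \<in> V"
  using cone_V by (auto simp: cone_def)

lemma add_in_V: "v \<in> V \<Longrightarrow> w \<in> V \<Longrightarrow> v + w \<in> V"
  using convex_cone[THEN iffD1, OF conjI[OF convex_V cone_V]] by simp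

lemma add_eq_0_in_V:
  assumes "v \<in> V" "w \<in> V" "v + w = 0"
  shows "v = 0"
proof -
  have "v = - w" using assms(3) by (simp add: eq_neg_iff_add_eq_0)
  then have "v \<in> V \<inter> uminus ` V" using assms by blast
  then show ?thesis using pointed_V unfolding pointed_def by blast
qed

lemma recession_cone_V: "recession_cone V = V"
proof
  show "recession_cone V \<subseteq> V"
  proof
    fix x assume "x \<in> recession_cone V"
    then have "x + 0 \<in> V" using zero_in_V unfolding recession_cone_def by blast
    then show "x \<in> V" by simp
  qed
qed (auto simp: recession_cone_def add_in_V)

lemma V_in_closed_convex_sets: "V \<in> closed_convex_sets V"
  using closed_V convex_V recession_cone_V zero_in_V by (auto simp: closed_convex_sets_def)

lemma closed_convex_setsD:
  assumes "K \<in> closed_convex_sets V"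
  shows "K \<noteq> {}" "closed K" "convex K" "recession_cone K = V"
  using assms by (auto simp: closed_convex_sets_def)

lemma add_V_in:
  assumes "K \<in> closed_convex_sets V" "k \<in> K" "v \<in> V"
  shows "k + v \<in> K"
  using assms by (auto simp: closed_convex_sets_def recession_cone_def add.commute)

lemma plus_V:
  assumes "K \<in> closed_convex_sets V"
  shows "K + V = K"
proof
  show "K + V \<subseteq> K" using add_V_in[OF assms] by (auto simp: set_plus_def)
  show "K \<subseteq> K + V" using zero_in_V set_zero_plus2[of V K] by (simp add: add.commute)
qed

text \<open>If \<open>v\<close> is a recession direction of \<open>P + K\<close>, the \<open>K\<close>-components of the points \<open>p + k + n v\<close>
  stay within bounded distance of \<open>n v\<close>, because \<open>P\<close> is bounded.\<close>
lemma compact_plus_in_closed_convex_sets: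
  assumes P: "compact P" "convex P" "P \<noteq> {}" and K: "K \<in> closed_convex_sets V"
  shows "P + K \<in> closed_convex_sets V"
proof -
  note K' = closed_convex_setsD[OF K]
  have "recession_cone (P + K) \<subseteq> V"
  proof
    fix v assume v: "v \<in> recession_cone (P + K)"
    obtain p0 k0 where pk0: "p0 \<in> P" "k0 \<in> K" using P(3) K'(1) by auto
    have "\<exists>p k. p0 + k0 + real n *\<^sub>R v = p + k \<and> p \<in> P \<and> k \<in> K" for n
      using recession_cone_add_multiple[OF v set_plus_intro[OF pk0], of n]
        by (auto simp: set_plus_def)
    then obtain p k where pk: "\<And>n. p0 + k0 + real n *\<^sub>R v = p n + k n" "\<And>n. p n \<in> P" "\<And>n. k n \<in> K"
      by metis
    obtain b where b: "\<And>x. x \<in> P \<Longrightarrow> norm x \<le> b"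
      using P(1) compact_imp_bounded bounded_iff by metis
    have "v \<in> recession_cone K"
    proof (rule recession_cone_approx[OF K'(2,3) pk(3)])
      fix n
      have "k n - real n *\<^sub>R v = p0 + k0 - p n" using pk(1)[of n] by (simp add: algebra_simps)
      then have "norm (k n - real n *\<^sub>R v) \<le> norm (p0 + k0) + norm (p n)"
        by (simp add: norm_triangle_ineq4)
      then show "norm (k n - real n *\<^sub>R v) \<le> norm (p0 + k0) + b" using b[OF pk(2)[of n]] by simp
    qed
    then show "v \<in> V" using K' by simp
  qed
  moreover have "V \<subseteq> recession_cone (P + K)"
  proof
    fix v assume "v \<in> V"
    then have "v + (p + k) \<in> P + K" if "p \<in> P" "k \<in> K" for p k
      using add_V_in[OF K that(2), of v] that(1) set_plus_intro[of p P "k + v" K]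
        by (simp add: algebra_simps)
    then show "v \<in> recession_cone (P + K)" by (auto simp: recession_cone_def set_plus_def)
  qed
  ultimately show ?thesis
    using closed_compact_plus[OF P(1) K'(2)] convex_set_plus[OF P(2) K'(3)] P(3) K'(1)
    by (auto simp: closed_convex_sets_def)
qed

lemma compact_plus_V_in_closed_convex_sets:
  assumes "compact P" "convex P" "P \<noteq> {}"
  shows "P + V \<in> closed_convex_sets V"
  using compact_plus_in_closed_convex_sets[OF assms V_in_closed_convex_sets] .

text \<open>By homogeneity only unit vectors of \<open>V\<close> matter, and they form a compact set, so \<open>v \<bullet> x\<close> is
  bounded away from \<open>0\<close> on them.\<close>
lemma open_strict_polar: "open (strict_polar V)"
proof -
  have "\<exists>e>0. ball x e \<subseteq> strict_polar V" if x: "x \<in> strict_polar V" for x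
  proof (cases "V \<inter> sphere 0 1 = {}")
    case True
    have "v = 0" if "v \<in> V" for v
    proof (rule ccontr)
      assume "v \<noteq> 0"
      then have "v /\<^sub>R norm v \<in> V \<inter> sphere 0 1"
        using scale_in_V[OF that, of "inverse (norm v)"] by simp
      then show False using True by simp
    qed
    then have "strict_polar V = UNIV" by (auto simp: strict_polar_def)
    then show ?thesis by (auto intro: exI[of _ 1])
  next
    case False
    have "compact (V \<inter> sphere 0 1)" using closed_V by (simp add: closed_Int_compact)
    moreover have "continuous_on (V \<inter> sphere 0 1) (\<lambda>v. v \<bullet> x)" by (intro continuous_intros)
    ultimately obtain v0 where v0: "v0 \<in> V" "norm v0 = 1" "\<And>v. v \<in> V \<Longrightarrow> norm v = 1 \<Longrightarrow> v \<bullet> x \<le> v0 \<bullet> x"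
      using continuous_attains_sup[OF _ False] by (metis (no_types, lifting) IntE IntI mem_sphere_0)
    have neg: "v0 \<bullet> x < 0" using v0 x by (force simp: strict_polar_def)
    have "ball x (- (v0 \<bullet> x)) \<subseteq> strict_polar V"
    proof
      fix y assume "y \<in> ball x (- (v0 \<bullet> x))"
      then have y: "norm (y - x) < - (v0 \<bullet> x)" by (simp add: dist_norm norm_minus_commute)
      have "v \<bullet> y < 0" if v: "v \<in> V" "v \<noteq> 0" for v
      proof -
        have "(v /\<^sub>R norm v) \<bullet> x \<le> v0 \<bullet> x"
          using v0(3)[of "v /\<^sub>R norm v"] scale_in_V[OF v(1), of "inverse (norm v)"] v(2) by simp
        then have "v \<bullet> x \<le> norm v * (v0 \<bullet> x)" using v(2) by (simp add: field_simps)
        moreover have "v \<bullet> (y - x) \<le> norm v * norm (y - x)" by (rule norm_cauchy_schwarz)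
        moreover have "norm v * norm (y - x) < norm v * - (v0 \<bullet> x)"
          using y v(2) by (intro mult_strict_left_mono) auto
        ultimately show ?thesis by (simp add: inner_diff_right)
      qed
      then show "y \<in> strict_polar V" by (auto simp: strict_polar_def)
    qed
    then show ?thesis using neg by (intro exI[of _ "- (v0 \<bullet> x)"]) simp
  qed
  then show ?thesis using open_contains_ball by metis
qed

text \<open>Pointedness makes \<open>V - {0}\<close> convex. Hence \<open>0\<close> is not in the convex hull of the unit
  vectors of \<open>V\<close> and can be separated from this compact set.\<close>
lemma strict_polar_nonempty: "strict_polar V \<noteq> {}"
proof -
  let ?S = "V \<inter> sphere 0 1"
  have "convex (V - {0})"
  proof (rule convexI)
    fix x y and u v :: real
    assume *: "x \<in> V - {0}" "y \<in> V - {0}" "0 \<le> u" "0 \<le> v" "u + v = 1"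
    then have **: "u *\<^sub>R x \<in> V" "v *\<^sub>R y \<in> V" by (auto simp: scale_in_V)
    have "u *\<^sub>R x + v *\<^sub>R y \<noteq> 0"
    proof
      assume 0: "u *\<^sub>R x + v *\<^sub>R y = 0"
      then have "u *\<^sub>R x = 0" using add_eq_0_in_V ** by blast
      then show False using * 0 by auto
    qed
    then show "u *\<^sub>R x + v *\<^sub>R y \<in> V - {0}" using ** by (simp add: add_in_V)
  qed
  then have "convex hull ?S \<subseteq> V - {0}" by (intro hull_minimal) auto
  then have "0 \<notin> convex hull ?S" by auto
  moreover have "compact (convex hull ?S)"
    using closed_V by (intro compact_convex_hull) (simp add: closed_Int_compact)
  ultimately obtain a b where ab: "0 < b" "\<And>x. x \<in> convex hull ?S \<Longrightarrow> a \<bullet> x > b"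
    using separating_hyperplane_closed_0[of "convex hull ?S"] compact_imp_closed
      by (metis convex_convex_hull)
  have "v \<bullet> (- a) < 0" if v: "v \<in> V" "v \<noteq> 0" for v
  proof -
    have "v /\<^sub>R norm v \<in> ?S" using v scale_in_V[OF v(1), of "inverse (norm v)"] by simp
    then have "a \<bullet> (v /\<^sub>R norm v) > 0" using ab hull_inc[of _ ?S convex] by fastforce
    then show ?thesis using v(2) by (simp add: inner_commute zero_less_mult_iff)
  qed
  then show ?thesis unfolding strict_polar_def by blast
qed

lemma convex_strict_polar: "convex (strict_polar V)"
proof (rule convexI)
  fix x y and s t :: real
  assume *: "x \<in> strict_polar V" "y \<in> strict_polar V" "0 \<le> s" "0 \<le> t" "s + t = 1"
  have "v \<bullet> (s *\<^sub>R x + t *\<^sub>R y) < 0" if "v \<in> V" "v \<noteq> 0" for v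
  proof -
    have "v \<bullet> x < 0" "v \<bullet> y < 0" using * that by (auto simp: strict_polar_def)
    moreover have "s > 0 \<or> t > 0" using * by linarith
    ultimately have "s * (v \<bullet> x) + t * (v \<bullet> y) < 0"
      using * by (metis add_neg_nonpos add_nonpos_neg mult_nonneg_nonpos mult_pos_neg
          order_less_imp_le)
    then show ?thesis by (simp add: inner_add_right)
  qed
  then show "s *\<^sub>R x + t *\<^sub>R y \<in> strict_polar V" by (auto simp: strict_polar_def)
qed

text \<open>An unbounded superlevel set would contain points whose normalisations accumulate at a
  recession direction \<open>v\<close> with \<open>0 \<le> v \<bullet> x\<close>, which is impossible for \<open>x\<close> in the strict polar.\<close>
lemma strict_polar_attains:
  assumes K: "K \<in> closed_convex_sets V" and x: "x \<in> strict_polar V"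
  obtains k where "k \<in> K" "\<And>k'. k' \<in> K \<Longrightarrow> k' \<bullet> x \<le> k \<bullet> x"
proof -
  note K' = closed_convex_setsD[OF K]
  obtain k0 where k0: "k0 \<in> K" using K' by auto
  \<comment> \<open>The points at least as high as \<open>k0\<close>; it suffices that they form a compact set.\<close>
  define S where "S = K \<inter> {k. k0 \<bullet> x \<le> k \<bullet> x}"
  have "closed S" unfolding S_def using K'
    by (intro closed_Int closed_Collect_le continuous_intros) auto
  have "bounded S"
  proof (rule ccontr)
    assume "\<not> bounded S"
    then have "\<exists>s\<in>S. norm s > real (Suc n)" for n by (meson bounded_iff not_le)
    then obtain s where s: "\<And>n. s n \<in> S" "\<And>n. norm (s n) > real (Suc n)" by metis
    have pos: "norm (s n) > 0" for n using s(2)[of n] by linarith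
    define w where "w n = s n /\<^sub>R norm (s n)" for n
    have "w n \<in> sphere 0 1" for n using pos[of n] by (simp add: w_def)
    then obtain v h where v: "v \<in> sphere 0 1" and h: "strict_mono (h :: nat \<Rightarrow> nat)"
        and lim: "(w \<circ> h) \<longlonglongrightarrow> v"
      using compact_sphere[of "0::'a" 1] by (metis compact_eq_seq_compact_metric seq_compactE)
    have r: "(\<lambda>n. inverse (norm (s n))) \<longlonglongrightarrow> 0"
    proof (rule Lim_null_comparison)
      show "\<forall>\<^sub>F n in sequentially. norm (inverse (norm (s n))) \<le> inverse (real (Suc n))"
        using s(2) by (intro always_eventually allI) (simp add: less_imp_le le_imp_inverse_le del:
            of_nat_Suc)
    qed (rule LIMSEQ_inverse_real_of_nat)
    have rh: "(\<lambda>n. inverse (norm (s (h n)))) \<longlonglongrightarrow> 0"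
      using LIMSEQ_subseq_LIMSEQ[OF r h] by (simp add: o_def)
    have lim': "(\<lambda>n. inverse (norm (s (h n))) *\<^sub>R s (h n)) \<longlonglongrightarrow> v" using lim by (simp add: o_def w_def)
    have "v \<in> recession_cone K"
      by (rule recession_cone_limit[OF K'(2,3) _ rh _ lim']) (use s in \<open>auto simp: S_def\<close>)
    then have "v \<bullet> x < 0" using x K'(4) v by (auto simp: strict_polar_def)
    moreover have "0 \<le> v \<bullet> x"
    proof (rule LIMSEQ_le)
      show "(\<lambda>n. inverse (norm (s (h n))) * (k0 \<bullet> x)) \<longlonglongrightarrow> 0"
        using tendsto_mult[OF rh tendsto_const[of "k0 \<bullet> x"]] by simp
      show "(\<lambda>n. (inverse (norm (s (h n))) *\<^sub>R s (h n)) \<bullet> x) \<longlonglongrightarrow> v \<bullet> x" by (intro tendsto_intros lim')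
      show "\<exists>N. \<forall>n\<ge>N. inverse (norm (s (h n))) * (k0 \<bullet> x) \<le>
          (inverse (norm (s (h n))) *\<^sub>R s (h n)) \<bullet> x"
        using s(1) by (auto simp: S_def intro!: mult_left_mono)
    qed
    ultimately show False by simp
  qed
  then have "compact S" using \<open>closed S\<close> compact_eq_bounded_closed by blast
  moreover have "S \<noteq> {}" using k0 by (auto simp: S_def)
  moreover have "continuous_on S (\<lambda>k. k \<bullet> x)" by (intro continuous_intros)
  ultimately obtain k where k: "k \<in> S" "\<And>k'. k' \<in> S \<Longrightarrow> k' \<bullet> x \<le> k \<bullet> x"
    using continuous_attains_sup by metis
  show thesis
  proof (rule that)
    show "k \<in> K" using k by (simp add: S_def)
    fix k' assume "k' \<in> K"
    then show "k' \<bullet> x \<le> k \<bullet> x" using k by (cases "k0 \<bullet> x \<le> k' \<bullet> x") (auto simp: S_def)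
  qed
qed

end

section \<open>Support functions and separation\<close>

definition support_fun :: "'a::euclidean_space set \<Rightarrow> 'a \<Rightarrow> real" where
  "support_fun K x = (SUP k\<in>K. k \<bullet> x)"

lemma support_fun_eqI:
  assumes "k \<in> K" "\<And>k'. k' \<in> K \<Longrightarrow> k' \<bullet> x \<le> k \<bullet> x"
  shows "support_fun K x = k \<bullet> x"
  unfolding support_fun_def using assms by (intro cSup_eq_maximum) auto

text \<open>This supplies the genericity used below: finitely many hyperplanes through the origin do
  not cover a nonempty open set.\<close>
lemma avoid_hyperplanes:
  fixes E :: "'a::euclidean_space set"
  assumes "finite E" "0 \<notin> E" "open U" "U \<noteq> {}"
  shows "\<exists>x\<in>U. \<forall>e\<in>E. e \<bullet> x \<noteq> 0"
  using assms
proof (induction E arbitrary: U rule: finite_induct)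
  case (insert e E)
  let ?U = "U - {x. e \<bullet> x = 0}"
  have "open ?U" using insert.prems(2) closed_hyperplane by (rule open_Diff)
  moreover have "?U \<noteq> {}"
  proof
    assume "?U = {}"
    then have "U \<subseteq> interior {x. e \<bullet> x = 0}" using insert.prems(2) by (intro interior_maximal) auto
    moreover have "interior {x. e \<bullet> x = 0} = {}"
      using insert.prems(1) by (intro interior_hyperplane) auto
    ultimately show False using insert.prems(3) by auto
  qed
  ultimately obtain x where "x \<in> ?U" "\<forall>e\<in>E. e \<bullet> x \<noteq> 0" using insert.IH[of ?U] insert.prems by auto
  then show ?case by auto
qed auto

text \<open>Subtracting the chord from \<open>f 0 = 0\<close> to \<open>f 1 < 0\<close> would give a function that vanishes at
  both ends and is positive somewhere. At its smallest maximiser the local midpoint inequality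
  fails, since the value to the left is strictly smaller.\<close>
lemma nonneg_if_locally_midpoint_convex:
  fixes f :: "real \<Rightarrow> real"
  assumes cont: "continuous_on {0..1} f" and 0: "f 0 = 0"
    and start: "0 < d" "\<And>t. 0 < t \<Longrightarrow> t < d \<Longrightarrow> t \<le> 1 \<Longrightarrow> 0 \<le> f t"
    and mid: "\<And>t. 0 < t \<Longrightarrow> t < 1 \<Longrightarrow> \<exists>e>0. \<forall>h. 0 \<le> h \<longrightarrow> h \<le> e \<longrightarrow> 2 * f t \<le> f (t - h) + f (t + h)"
  shows "0 \<le> f 1"
proof (rule ccontr)
  assume neg: "\<not> 0 \<le> f 1"
  define g where "g t = f t - f 1 * t" for t
  have gcont: "continuous_on {0..1} g" unfolding g_def by (intro continuous_intros cont)
  then obtain m where m: "m \<in> {0..1}" "\<And>t. t \<in> {0..1} \<Longrightarrow> g t \<le> g m"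
    using continuous_attains_sup[of "{0..1::real}" g] by auto
  define T where "T = {t \<in> {0..1}. g t = g m}"
  have "closed T" unfolding T_def by (rule continuous_closed_preimage_constant[OF gcont]) simp
  moreover have "bounded T" by (rule bounded_subset[of "{0..1}"]) (auto simp: T_def)
  ultimately have "compact T" by (simp add: compact_eq_bounded_closed)
  moreover have "m \<in> T" using m by (simp add: T_def)
  ultimately obtain t where t: "t \<in> T" "\<And>s. s \<in> T \<Longrightarrow> t \<le> s"
    using compact_attains_inf[of T] by auto
  have "0 < g m"
  proof -
    let ?s = "min (d/2) 1"
    have "0 \<le> f ?s" using start by (intro start(2)) auto
    moreover have "f 1 * ?s < 0" using neg start by (intro mult_neg_pos) auto
    ultimately have "0 < g ?s" unfolding g_def by linarith
    also have "\<dots> \<le> g m" using start by (intro m) auto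
    finally show ?thesis .
  qed
  moreover have "g 0 = 0" "g 1 = 0" using 0 by (auto simp: g_def)
  ultimately have t01: "0 < t" "t < 1" using t(1) by (auto simp: T_def less_le)
  obtain e where e: "e > 0" "\<And>h. 0 \<le> h \<Longrightarrow> h \<le> e \<Longrightarrow> 2 * f t \<le> f (t - h) + f (t + h)"
    using mid[OF t01] by auto
  define h where "h = min e (min t (1 - t))"
  have h: "0 < h" "h \<le> e" "h \<le> t" "h \<le> 1 - t" using e t01 by (auto simp: h_def)
  have "2 * g t \<le> g (t - h) + g (t + h)"
    using e(2)[of h] h by (simp add: g_def algebra_simps)
  moreover have "g (t + h) \<le> g m" using h t01 by (intro m) auto
  moreover have "g (t - h) \<le> g m" using h t01 by (intro m) auto
  moreover have "g (t - h) \<noteq> g m" using t(2)[of "t - h"] h t01 by (auto simp: T_def)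
  moreover have "g t = g m" using t by (simp add: T_def)
  ultimately show False by linarith
qed

context pointed_closed_cone
begin

lemma support_fun_attained:
  assumes "K \<in> closed_convex_sets V" "x \<in> strict_polar V"
  obtains k where "k \<in> K" "support_fun K x = k \<bullet> x"
  using strict_polar_attains[OF assms] support_fun_eqI by metis

lemma inner_le_support_fun:
  assumes "K \<in> closed_convex_sets V" "x \<in> strict_polar V" "k \<in> K"
  shows "k \<bullet> x \<le> support_fun K x"
  using strict_polar_attains[OF assms(1,2)] support_fun_eqI assms(3) by metis

text \<open>A sum attains its maximum in direction \<open>x\<close> at the sum of two maximisers.\<close>
lemma support_fun_plus:
  assumes K: "K \<in> closed_convex_sets V" and L: "L \<in> closed_convex_sets V"
      and x: "x \<in> strict_polar V"
  shows "support_fun (K + L) x = support_fun K x + support_fun L x"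
proof -
  obtain k l where kl: "k \<in> K" "support_fun K x = k \<bullet> x" "l \<in> L" "support_fun L x = l \<bullet> x"
    using support_fun_attained[OF K x] support_fun_attained[OF L x] by metis
  have "support_fun (K + L) x = (k + l) \<bullet> x"
  proof (rule support_fun_eqI)
    show "k + l \<in> K + L" using kl by blast
    fix y assume "y \<in> K + L"
    then obtain k' l' where *: "y = k' + l'" "k' \<in> K" "l' \<in> L" by (auto simp: set_plus_def)
    then show "y \<bullet> x \<le> (k + l) \<bullet> x"
      using inner_le_support_fun[OF K x] inner_le_support_fun[OF L x] kl
      by (metis add_mono inner_add_left)
  qed
  then show ?thesis using kl by (simp add: inner_add_left)
qed

lemma convex_on_support_fun:
  assumes K: "K \<in> closed_convex_sets V"
  shows "convex_on (strict_polar V) (support_fun K)"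
proof (rule convex_onI[OF _ convex_strict_polar])
  fix t x y assume t: "0 < t" "t < (1::real)" and xy: "x \<in> strict_polar V" "y \<in> strict_polar V"
  let ?z = "(1 - t) *\<^sub>R x + t *\<^sub>R y"
  have "?z \<in> strict_polar V" using convexD[OF convex_strict_polar xy] t by simp
  then obtain k where k: "k \<in> K" "support_fun K ?z = k \<bullet> ?z"
    using support_fun_attained[OF K] by metis
  have "k \<bullet> ?z = (1 - t) * (k \<bullet> x) + t * (k \<bullet> y)" by (simp add: inner_add_right)
  also have "\<dots> \<le> (1 - t) * support_fun K x + t * support_fun K y"
    using t xy k(1) by (intro add_mono mult_left_mono inner_le_support_fun[OF K]) auto
  finally show "support_fun K ?z \<le> (1 - t) * support_fun K x + t * support_fun K y" using k by simp
qed

lemma continuous_on_support_fun: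
  assumes K: "K \<in> closed_convex_sets V"
  shows "continuous_on (strict_polar V) (support_fun K)"
  using convex_on_continuous[OF open_strict_polar convex_on_support_fun[OF K]] .

text \<open>A separating functional is in general only in the polar cone of \<open>V\<close>. Adding a small
  multiple of an element \<open>x1\<close> of the strict polar moves it into the strict polar; the separation
  survives because the support function of \<open>K\<close> is finite at \<open>x1\<close>.\<close>
lemma separation:
  assumes K: "K \<in> closed_convex_sets V" and z: "z \<notin> K"
  shows "\<exists>x\<in>strict_polar V. support_fun K x < z \<bullet> x"
proof -
  note K' = closed_convex_setsD[OF K]
  obtain a b where ab: "a \<bullet> z < b" "\<And>k. k \<in> K \<Longrightarrow> a \<bullet> k > b"
    using separating_hyperplane_closed_point[OF K'(3,2) z] by auto
  obtain x1 where x1: "x1 \<in> strict_polar V" using strict_polar_nonempty by auto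
  obtain k0 where k0: "k0 \<in> K" using K' by auto
  have a_V: "0 \<le> a \<bullet> v" if "v \<in> V" for v
  proof (rule ccontr)
    assume neg: "\<not> 0 \<le> a \<bullet> v"
    obtain n :: nat where n: "(a \<bullet> k0 - b) / - (a \<bullet> v) < real n" using reals_Archimedean2 by blast
    have "k0 + real n *\<^sub>R v \<in> K" using recession_cone_add_multiple K'(4) that k0 by metis
    from ab(2)[OF this] n neg show False by (simp add: field_simps inner_add_right)
  qed
  define r where "r = support_fun K x1 - z \<bullet> x1"
  \<comment> \<open>So small that the perturbation \<open>e * r\<close> does not use up the gap \<open>b - a \<bullet> z\<close>.\<close>
  define e where "e = (b - a \<bullet> z) / (\<bar>r\<bar> + 1)"
  have e: "e > 0" "e * r < b - a \<bullet> z"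
  proof -
    show "e > 0" using ab(1) by (simp add: e_def)
    then have "e * r < e * (\<bar>r\<bar> + 1)" by (intro mult_strict_left_mono) auto
    then show "e * r < b - a \<bullet> z" by (simp add: e_def)
  qed
  define x where "x = e *\<^sub>R x1 - a"
  have x: "x \<in> strict_polar V"
  proof -
    have "v \<bullet> x < 0" if "v \<in> V" "v \<noteq> 0" for v
    proof -
      have "e * (v \<bullet> x1) < 0" using e x1 that by (auto simp: strict_polar_def mult_pos_neg)
      then show ?thesis using a_V[OF that(1)] by (simp add: x_def inner_diff_right inner_commute)
    qed
    then show ?thesis by (auto simp: strict_polar_def)
  qed
  obtain k where k: "k \<in> K" "support_fun K x = k \<bullet> x" using support_fun_attained[OF K x] .
  have "e * (k \<bullet> x1) \<le> e * support_fun K x1" using inner_le_support_fun[OF K x1 k(1)] e by simp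
  then have "k \<bullet> x < z \<bullet> x" using ab(2)[OF k(1)] e(2)
    by (simp add: x_def inner_diff_right r_def algebra_simps inner_commute)
  then show ?thesis using x k by metis
qed

text \<open>Separation is an open condition on the direction, by continuity of the support function.\<close>
lemma generic_separation:
  assumes K: "K \<in> closed_convex_sets V" and z: "z \<notin> K" and E: "finite E" "0 \<notin> E"
  shows "\<exists>x\<in>strict_polar V. support_fun K x < z \<bullet> x \<and> (\<forall>e\<in>E. e \<bullet> x \<noteq> 0)"
proof -
  have "open (strict_polar V \<inter> (\<lambda>x. support_fun K x - z \<bullet> x) -` {..<0})"
    by (intro continuous_open_preimage continuous_intros continuous_on_support_fun K
        open_strict_polar open_lessThan)
  moreover have "strict_polar V \<inter> (\<lambda>x. support_fun K x - z \<bullet> x) -` {..<0} \<noteq> {}"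
    using separation[OF K z] by auto
  ultimately show ?thesis using avoid_hyperplanes[OF E] by fastforce
qed

text \<open>The order cancellation law. It fails for general unbounded sets; here it holds because the
  summand \<open>A\<close> has a maximiser in each of the directions that suffice for separation.\<close>
lemma plus_subset_cancel:
  assumes A: "A \<in> closed_convex_sets V" and D: "D \<in> closed_convex_sets V" and sub: "A + X \<subseteq> A + D"
  shows "X \<subseteq> D"
proof
  fix z assume z: "z \<in> X"
  show "z \<in> D"
  proof (rule ccontr)
    assume "z \<notin> D"
    then obtain x where x: "x \<in> strict_polar V" "support_fun D x < z \<bullet> x"
      using separation[OF D] by auto
    obtain a where a: "a \<in> A" "support_fun A x = a \<bullet> x" using support_fun_attained[OF A x(1)] .
    have "a + z \<in> A + D" using sub a z by blast
    then obtain a' d where "a + z = a' + d" "a' \<in> A" "d \<in> D" by (auto simp: set_plus_def)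
    then have "a \<bullet> x + z \<bullet> x \<le> a \<bullet> x + support_fun D x"
      using inner_le_support_fun[OF A x(1)] inner_le_support_fun[OF D x(1)] a
        by (metis add_mono inner_add_left)
    then show False using x by simp
  qed
qed

end

section \<open>Faces of polytopes and generic segments\<close>

text \<open>Used with convex hulls to show that points of maximal height arise from maximal generators
  only.\<close>
lemma convex_halfspace_Un:
  fixes J :: "'a::real_inner set"
  assumes J: "convex J" "\<And>y. y \<in> J \<Longrightarrow> y \<bullet> u \<le> b"
  shows "convex ({y. y \<bullet> u < b} \<union> J)"
proof (rule convexI)
  fix x y and s t :: real
  assume *: "x \<in> {y. y \<bullet> u < b} \<union> J" "y \<in> {y. y \<bullet> u < b} \<union> J" "0 \<le> s" "0 \<le> t" "s + t = 1"
  have le: "x \<bullet> u \<le> b" "y \<bullet> u \<le> b" using * J(2) by auto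
  show "s *\<^sub>R x + t *\<^sub>R y \<in> {y. y \<bullet> u < b} \<union> J"
  proof (cases "(x \<in> J \<and> y \<in> J) \<or> s = 0 \<or> t = 0")
    case True
    then show ?thesis using * convexD[OF J(1)] by auto
  next
    case False
    then have st: "0 < s" "0 < t" and or: "x \<bullet> u < b \<or> y \<bullet> u < b" using * by auto
    have "s * (x \<bullet> u) + t * (y \<bullet> u) < s * b + t * b"
      using or
    proof
      assume "x \<bullet> u < b"
      then show ?thesis using st le
        by (intro add_less_le_mono mult_strict_left_mono mult_left_mono) auto
    next
      assume "y \<bullet> u < b"
      then show ?thesis using st le
        by (intro add_le_less_mono mult_strict_left_mono mult_left_mono) auto
    qed
    also have "\<dots> = b" using *(5) by (metis distrib_right mult_1)
    finally show ?thesis by (simp add: inner_add_left)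
  qed
qed

lemma finite_attains_inner:
  fixes F :: "'a::real_inner set"
  assumes "finite F" "F \<noteq> {}"
  obtains p where "p \<in> F" "\<And>f. f \<in> F \<Longrightarrow> f \<bullet> x \<le> p \<bullet> x"
proof -
  have "Max ((\<lambda>f. f \<bullet> x) ` F) \<in> (\<lambda>f. f \<bullet> x) ` F" using assms by (intro Max_in) auto
  then show thesis using that assms
    by (metis (no_types, lifting) Max_ge finite_imageI imageE imageI)
qed

text \<open>For a vertex set these vectors contain the normals of all hyperplanes along which the
  support function of the polytope can have a crease.\<close>
definition differences :: "'a::real_vector set \<Rightarrow> 'a set" where
  "differences S = {s - s' | s s'. s \<in> S \<and> s' \<in> S \<and> s \<noteq> s'}"

lemma finite_differences: "finite S \<Longrightarrow> finite (differences S)"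
proof -
  assume "finite S"
  then have "finite ((\<lambda>(s, s'). s - s') ` (S \<times> S))" by simp
  then show ?thesis by (rule rev_finite_subset) (auto simp: differences_def)
qed

lemma zero_notin_differences: "0 \<notin> differences S"
  by (auto simp: differences_def)

text \<open>The extreme parameters along the line give the end points.\<close>
lemma convex_hull_collinear:
  fixes S :: "'a::real_vector set"
  assumes S: "finite S" "p \<in> S" "p + w \<in> S" "w \<noteq> 0" and col: "\<And>f. f \<in> S \<Longrightarrow> \<exists>t. f = p + t *\<^sub>R w"
  shows "\<exists>a b s. convex hull S = closed_segment a b \<and> b - a = s *\<^sub>R w \<and> s \<noteq> 0"
proof -
  define T where "T = (\<lambda>t. p + t *\<^sub>R w) -` S"
  have "finite T" unfolding T_def using S by (intro finite_vimageI) (auto simp: inj_on_def)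
  moreover have T01: "0 \<in> T" "1 \<in> T" using S by (auto simp: T_def)
  ultimately have T: "Min T \<in> T" "Max T \<in> T" "\<And>t. t \<in> T \<Longrightarrow> Min T \<le> t \<and> t \<le> Max T"
    by (auto intro: Min_in Max_in)
  then have less: "Min T < Max T" using T(3)[OF T01(1)] T(3)[OF T01(2)] by linarith
  let ?a = "p + Min T *\<^sub>R w" and ?b = "p + Max T *\<^sub>R w"
  have "convex hull S = closed_segment ?a ?b"
  proof
    show "convex hull S \<subseteq> closed_segment ?a ?b"
    proof (rule hull_minimal)
      show "S \<subseteq> closed_segment ?a ?b"
      proof
        fix f assume f: "f \<in> S"
        then obtain t where t: "f = p + t *\<^sub>R w" using col by auto
        then have le: "Min T \<le> t" "t \<le> Max T" using T(3)[of t] f by (auto simp: T_def)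
        define r where "r = (t - Min T) / (Max T - Min T)"
        have r: "0 \<le> r" "r \<le> 1" "Min T + r * (Max T - Min T) = t"
          using le less by (auto simp: r_def)
        have "f = p + (Min T + r * (Max T - Min T)) *\<^sub>R w" using t r by simp
        also have "\<dots> = (1 - r) *\<^sub>R ?a + r *\<^sub>R ?b" by (simp add: algebra_simps)
        finally show "f \<in> closed_segment ?a ?b" using r by (auto simp: closed_segment_def)
      qed
    qed simp
    show "closed_segment ?a ?b \<subseteq> convex hull S"
      unfolding segment_convex_hull using T by (intro hull_mono) (auto simp: T_def)
  qed
  moreover have "?b - ?a = (Max T - Min T) *\<^sub>R w" by (simp add: algebra_simps)
  moreover have "Max T - Min T \<noteq> 0" using less by simp
  ultimately show ?thesis by blast
qed

text \<open>A segment from \<open>x\<close> meets the subspace orthogonal to \<open>e\<close> and \<open>f\<close> only if its other end lies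
  in the span of \<open>x\<close> and this subspace. For \<open>e\<close>, \<open>f\<close> linearly independent and \<open>x\<close> off their
  hyperplanes, that span is the hyperplane with the normal listed here. Dependent pairs give
  \<open>0\<close>, and are removed.\<close>
definition codim2_span_normals :: "'a::real_inner set \<Rightarrow> 'a \<Rightarrow> 'a set" where
  "codim2_span_normals E x = {(f \<bullet> x) *\<^sub>R e - (e \<bullet> x) *\<^sub>R f | e f. e \<in> E \<and> f \<in> E} - {0}"

lemma finite_codim2_span_normals: "finite E \<Longrightarrow> finite (codim2_span_normals E x)"
proof -
  assume "finite E"
  then have "finite ((\<lambda>(e, f). (f \<bullet> x) *\<^sub>R e - (e \<bullet> x) *\<^sub>R f) ` (E \<times> E))" by simp
  then show ?thesis by (rule rev_finite_subset) (auto simp: codim2_span_normals_def)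
qed

text \<open>A generic segment crosses the hyperplanes orthogonal to elements of \<open>E\<close> one at a time, up
  to proportional normals.\<close>
lemma parallel_if_common_wall:
  fixes x y :: "'a::real_inner"
  assumes x: "\<And>e. e \<in> E \<Longrightarrow> e \<bullet> x \<noteq> 0"
    and y: "\<And>e. e \<in> codim2_span_normals E x \<Longrightarrow> e \<bullet> y \<noteq> 0"
    and ef: "e \<in> E" "f \<in> E" and z: "e \<bullet> (x + t *\<^sub>R (y - x)) = 0" "f \<bullet> (x + t *\<^sub>R (y - x)) = 0"
  shows "\<exists>r. e = r *\<^sub>R f"
proof -
  have "t \<noteq> 0" using z(1) x ef by auto
  define g where "g = (f \<bullet> x) *\<^sub>R e - (e \<bullet> x) *\<^sub>R f"
  have gx: "g \<bullet> x = 0" by (simp add: g_def inner_diff_left)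
  have "g \<bullet> (x + t *\<^sub>R (y - x)) = 0" using z by (simp add: g_def inner_diff_left)
  then have "t * (g \<bullet> y) = 0" using gx by (simp add: inner_add_right inner_diff_right)
  then have "g \<bullet> y = 0" using \<open>t \<noteq> 0\<close> by simp
  then have "g = 0" using y ef unfolding codim2_span_normals_def g_def by blast
  then have "(f \<bullet> x) *\<^sub>R e = (e \<bullet> x) *\<^sub>R f" by (simp add: g_def)
  then have "(1 / (f \<bullet> x)) *\<^sub>R ((f \<bullet> x) *\<^sub>R e) = (1 / (f \<bullet> x)) *\<^sub>R ((e \<bullet> x) *\<^sub>R f)" by simp
  then have "e = ((e \<bullet> x) / (f \<bullet> x)) *\<^sub>R f" using x[OF ef(2)] by simp
  then show ?thesis ..
qed

lemma unique_maximizer_nearby: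
  fixes F :: "'a::real_inner set"
  assumes "finite F" "\<And>f. f \<in> F \<Longrightarrow> f \<noteq> p \<Longrightarrow> f \<bullet> z < p \<bullet> z"
  shows "\<forall>\<^sub>F h in nhds (0::real). \<forall>f\<in>F. f \<bullet> (z + h *\<^sub>R w) \<le> p \<bullet> (z + h *\<^sub>R w)"
proof (rule eventually_ball_finite[OF assms(1)], rule ballI)
  fix f assume f: "f \<in> F"
  show "\<forall>\<^sub>F h in nhds (0::real). f \<bullet> (z + h *\<^sub>R w) \<le> p \<bullet> (z + h *\<^sub>R w)"
  proof (cases "f = p")
    case False
    have "open {h. f \<bullet> (z + h *\<^sub>R w) < p \<bullet> (z + h *\<^sub>R w)}"
      by (intro open_Collect_less continuous_intros)
    then have "\<forall>\<^sub>F h in nhds (0::real). h \<in> {h. f \<bullet> (z + h *\<^sub>R w) < p \<bullet> (z + h *\<^sub>R w)}"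
      using assms(2)[OF f False] by (intro eventually_nhds_in_open) auto
    then show ?thesis by eventually_elim simp
  qed simp
qed

context pointed_closed_cone
begin

text \<open>Generators below the maximal height and nonzero elements of the cone strictly decrease the
  height, so only \<open>J\<close> itself remains on top.\<close>
lemma support_set_hull_plus_V:
  assumes u: "u \<in> strict_polar V" and J: "convex J" "J \<noteq> {}" "\<And>y. y \<in> J \<Longrightarrow> y \<bullet> u = b"
    and T: "\<And>y. y \<in> T \<Longrightarrow> y \<bullet> u < b"
  shows "support_set (convex hull (J \<union> T) + V) u = J"
proof -
  let ?K = "convex hull (J \<union> T) + V"
  have sub: "convex hull (J \<union> T) \<subseteq> {y. y \<bullet> u < b} \<union> J"
    using J T by (intro hull_minimal convex_halfspace_Un) auto
  have K: "k \<bullet> u \<le> b \<and> (k \<bullet> u = b \<longrightarrow> k \<in> J)" if k: "k \<in> ?K" for k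
  proof -
    obtain c v where c: "k = c + v" "c \<in> convex hull (J \<union> T)" "v \<in> V"
      using k by (auto simp: set_plus_def)
    have "c \<bullet> u \<le> b" "c \<bullet> u = b \<Longrightarrow> c \<in> J" using sub c(2) J(3) by force+
    moreover have "v \<bullet> u \<le> 0" "v \<bullet> u = 0 \<Longrightarrow> v = 0" using u c(3) by (force simp: strict_polar_def)+
    moreover have "k \<bullet> u = c \<bullet> u + v \<bullet> u" using c(1) by (simp add: inner_add_left)
    ultimately have "k \<bullet> u \<le> b" "k \<bullet> u = b \<Longrightarrow> c \<in> J \<and> v = 0"
      by (linarith, smt (verit))
    then show ?thesis using c(1) by auto
  qed
  have "J \<subseteq> ?K"
  proof
    fix j assume "j \<in> J"
    then have "j + 0 \<in> ?K" using zero_in_V by (intro set_plus_intro) (auto intro: hull_inc)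
    then show "j \<in> ?K" by simp
  qed
  show ?thesis
  proof
    show "J \<subseteq> support_set ?K u"
      unfolding support_set_def using \<open>J \<subseteq> ?K\<close> J(3) K by auto
    obtain j where j: "j \<in> J" using J(2) by blast
    show "support_set ?K u \<subseteq> J"
    proof
      fix k assume k: "k \<in> support_set ?K u"
      then have "k \<in> ?K" "j \<bullet> u \<le> k \<bullet> u" using \<open>J \<subseteq> ?K\<close> j unfolding support_set_def by auto
      then show "k \<in> J" using K[of k] J(3)[OF j] by linarith
    qed
  qed
qed

lemma V_polytope_in_closed_convex_sets:
  assumes "finite F" "F \<noteq> {}"
  shows "convex hull F + V \<in> closed_convex_sets V"
  using assms by (intro compact_plus_V_in_closed_convex_sets finite_imp_compact_convex_hull) auto

lemma support_fun_V_polytope: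
  assumes x: "x \<in> strict_polar V" and p: "p \<in> F" "\<And>f. f \<in> F \<Longrightarrow> f \<bullet> x \<le> p \<bullet> x"
  shows "support_fun (convex hull F + V) x = p \<bullet> x"
proof (rule support_fun_eqI)
  show "p \<in> convex hull F + V"
    using set_plus_intro[OF hull_inc[OF p(1), of convex] zero_in_V] by simp
  fix k assume "k \<in> convex hull F + V"
  then obtain q v where q: "k = q + v" "q \<in> convex hull F" "v \<in> V" by (auto simp: set_plus_def)
  have "convex hull F \<subseteq> {q. x \<bullet> q \<le> p \<bullet> x}"
    using p by (intro hull_minimal convex_halfspace_le) (auto simp: inner_commute)
  then have "q \<bullet> x \<le> p \<bullet> x" using q by (auto simp: inner_commute)
  moreover have "v \<bullet> x \<le> 0" using q x by (force simp: strict_polar_def)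
  ultimately show "k \<bullet> x \<le> p \<bullet> x" using q by (simp add: inner_add_left)
qed

text \<open>The support set is the convex hull of the maximal vertices, which is a segment when they
  are collinear.\<close>
lemma support_set_V_polytope_edge:
  assumes z: "z \<in> strict_polar V" and F: "finite F" "p \<in> F" "p' \<in> F" "p \<noteq> p'"
      "\<And>f. f \<in> F \<Longrightarrow> f \<bullet> z \<le> p \<bullet> z" "p' \<bullet> z = p \<bullet> z"
    and par: "\<And>f. f \<in> F \<Longrightarrow> f \<noteq> p \<Longrightarrow> f \<bullet> z = p \<bullet> z \<Longrightarrow> \<exists>r. f - p = r *\<^sub>R w" and w: "p' - p = r0 *\<^sub>R w"
  shows "\<exists>a b s. support_set (convex hull F + V) z = closed_segment a b \<and> b - a = s *\<^sub>R w \<and> s \<noteq> 0"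
proof -
  let ?S = "{f \<in> F. f \<bullet> z = p \<bullet> z}"
  have r0: "r0 \<noteq> 0" using F w by auto
  have col: "\<exists>t. f = p + t *\<^sub>R (p' - p)" if f: "f \<in> ?S" for f
  proof (cases "f = p")
    case False
    then obtain r where r: "f - p = r *\<^sub>R w" using par f by auto
    then have "f = p + (r / r0) *\<^sub>R (p' - p)" using r0 w by (simp add: algebra_simps)
    then show ?thesis ..
  qed (auto intro: exI[of _ 0])
  have "\<exists>a b s. convex hull ?S = closed_segment a b \<and> b - a = s *\<^sub>R (p' - p) \<and> s \<noteq> 0"
  proof (rule convex_hull_collinear[of ?S p "p' - p"])
    show "finite ?S" "p \<in> ?S" "p + (p' - p) \<in> ?S" "p' - p \<noteq> 0" using F by auto
  qed (rule col)
  then obtain a b s where ab: "convex hull ?S = closed_segment a b" "b - a = s *\<^sub>R (p' - p)" "s \<noteq> 0"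
    by blast
  have "convex hull ?S \<subseteq> {y. z \<bullet> y = p \<bullet> z}"
    by (intro hull_minimal convex_hyperplane) (auto simp: inner_commute)
  then have S_face: "y \<bullet> z = p \<bullet> z"
    if "y \<in> convex hull ?S" for y using that by (auto simp: inner_commute)
  have "support_set (convex hull (convex hull ?S \<union> (F - ?S)) + V) z = convex hull ?S"
  proof (rule support_set_hull_plus_V[OF z, where b = "p \<bullet> z"])
    show "convex hull ?S \<noteq> {}" using F by auto
    show "y \<bullet> z < p \<bullet> z" if "y \<in> F - ?S" for y using that F(5)[of y] by auto
    show "convex (convex hull ?S)" by (rule convex_convex_hull)
    show "y \<bullet> z = p \<bullet> z" if "y \<in> convex hull ?S" for y by (rule S_face[OF that])
  qed
  moreover have "convex hull (convex hull ?S \<union> (F - ?S)) = convex hull F"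
  proof -
    have "?S \<union> (F - ?S) = F" by blast
    then show ?thesis using hull_Un_left[of convex ?S "F - ?S"] by metis
  qed
  ultimately have "support_set (convex hull F + V) z = closed_segment a b" using ab by simp
  moreover have "b - a = (s * r0) *\<^sub>R w" "s * r0 \<noteq> 0" using ab w r0 by simp_all
  ultimately show ?thesis by blast
qed

text \<open>This is where the absence of equiparallel edges enters. If several vertices of both
  polytopes were maximal at \<open>z\<close>, all differences of maximal vertices would be proportional, and
  both support sets would be parallel segments.\<close>
lemma unique_maximizer_if_no_equiparallel_edges:
  assumes F: "finite F" "F \<noteq> {}" and G: "finite G" "G \<noteq> {}"
    and no_eq: "no_equiparallel_edges (convex hull F + V) (convex hull G + V)"
    and z: "z \<in> strict_polar V"
    and par: "\<And>e f. e \<in> differences F \<union> differences G \<Longrightarrow> f \<in> differences F \<union> differences G \<Longrightarrow>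
       e \<bullet> z = 0 \<Longrightarrow> f \<bullet> z = 0 \<Longrightarrow> \<exists>r. e = r *\<^sub>R f"
  shows "(\<exists>p\<in>F. \<forall>f\<in>F. f \<noteq> p \<longrightarrow> f \<bullet> z < p \<bullet> z) \<or> (\<exists>q\<in>G. \<forall>g\<in>G. g \<noteq> q \<longrightarrow> g \<bullet> z < q \<bullet> z)"
proof (rule ccontr)
  assume neg: "\<not> ?thesis"
  obtain p where p: "p \<in> F" "\<And>f. f \<in> F \<Longrightarrow> f \<bullet> z \<le> p \<bullet> z"
    using finite_attains_inner[OF F, of z] by blast
  obtain q where q: "q \<in> G" "\<And>g. g \<in> G \<Longrightarrow> g \<bullet> z \<le> q \<bullet> z"
    using finite_attains_inner[OF G, of z] by blast
  obtain p' where p': "p' \<in> F" "p' \<noteq> p" "p' \<bullet> z = p \<bullet> z"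
  proof -
    have "\<not> (\<forall>f\<in>F. f \<noteq> p \<longrightarrow> f \<bullet> z < p \<bullet> z)" using neg p(1) by blast
    then show thesis using that p(2) by force
  qed
  obtain q' where q': "q' \<in> G" "q' \<noteq> q" "q' \<bullet> z = q \<bullet> z"
  proof -
    have "\<not> (\<forall>g\<in>G. g \<noteq> q \<longrightarrow> g \<bullet> z < q \<bullet> z)" using neg q(1) by blast
    then show thesis using that q(2) by force
  qed
  let ?E = "differences F \<union> differences G"
  define w where "w = p' - p"
  have w: "w \<in> ?E" "w \<bullet> z = 0" using p p' by (auto simp: w_def differences_def inner_diff_left)
  have *: "\<exists>r. f - p = r *\<^sub>R w" if "f \<in> F" "f \<noteq> p" "f \<bullet> z = p \<bullet> z" for f
    using that p(1) w by (intro par) (auto simp: differences_def inner_diff_left)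
  have **: "\<exists>r. g - q = r *\<^sub>R w" if "g \<in> G" "g \<noteq> q" "g \<bullet> z = q \<bullet> z" for g
    using that q(1) w by (intro par) (auto simp: differences_def inner_diff_left)
  obtain r0 where r0: "q' - q = r0 *\<^sub>R w" using ** q' by blast
  obtain a b s where ab: "support_set (convex hull F + V) z = closed_segment a b" "b - a = s *\<^sub>R w"
      "s \<noteq> 0"
    using support_set_V_polytope_edge[OF z F(1) p(1) p'(1) p'(2)[symmetric] p(2) p'(3) *, of 1]
    unfolding w_def by (metis scaleR_one)
  obtain c d s' where cd: "support_set (convex hull G + V) z = closed_segment c d"
      "d - c = s' *\<^sub>R w" "s' \<noteq> 0"
    using support_set_V_polytope_edge[OF z G(1) q(1) q'(1) q'(2)[symmetric] q(2) q'(3) ** r0]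
      by blast
  have "w \<noteq> 0" using p' by (simp add: w_def)
  moreover have "d - c = (s' / s) *\<^sub>R (b - a)" using ab cd by simp
  ultimately have "equiparallel_edges_at (convex hull F + V) (convex hull G + V) z"
    unfolding equiparallel_edges_at_def parallel_segments_def using ab cd
    by (metis bounded_closed_segment diff_self scaleR_eq_0_iff)
  then show False using no_eq by (simp add: no_equiparallel_edges_def)
qed

text \<open>Near a direction with a unique maximal vertex the support function of the \<open>V\<close>-polytope is
  linear, so the difference inherits convexity from the support function of \<open>K\<close>.\<close>
lemma support_fun_diff_midpoint_convex:
  assumes F: "finite F" "p \<in> F" "\<And>f. f \<in> F \<Longrightarrow> f \<noteq> p \<Longrightarrow> f \<bullet> z < p \<bullet> z"
    and K: "K \<in> closed_convex_sets V" and z: "z \<in> strict_polar V"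
  defines "g \<equiv> \<lambda>x. support_fun K x - support_fun (convex hull F + V) x"
  shows "\<exists>e>0. \<forall>h. 0 \<le> h \<longrightarrow> h \<le> e \<longrightarrow> 2 * g z \<le> g (z - h *\<^sub>R w) + g (z + h *\<^sub>R w)"
proof -
  have "open ((\<lambda>h. z + h *\<^sub>R w) -` strict_polar V)"
    by (intro continuous_open_vimage open_strict_polar) (auto intro!: continuous_intros)
  then have "\<forall>\<^sub>F h in nhds 0. h \<in> (\<lambda>h. z + h *\<^sub>R w) -` strict_polar V"
    using z by (intro eventually_nhds_in_open) auto
  from eventually_conj[OF this unique_maximizer_nearby[OF F(1,3), where w = w]]
  obtain e where e: "e > 0"
      "\<And>h. \<bar>h\<bar> < e \<Longrightarrow> z + h *\<^sub>R w \<in> strict_polar V \<and> (\<forall>f\<in>F. f \<bullet> (z + h *\<^sub>R w) \<le> p \<bullet> (z + h *\<^sub>R w))"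
    unfolding eventually_nhds_metric by (auto simp: dist_real_def)
  have g: "g (z + h *\<^sub>R w) = support_fun K (z + h *\<^sub>R w) - p \<bullet> (z + h *\<^sub>R w)" if "\<bar>h\<bar> < e" for h
    unfolding g_def using support_fun_V_polytope[OF _ F(2)] e(2)[OF that] by auto
  have "2 * g z \<le> g (z - h *\<^sub>R w) + g (z + h *\<^sub>R w)" if h: "0 \<le> h" "h \<le> e / 2" for h
  proof -
    have in_polar: "z + h *\<^sub>R w \<in> strict_polar V" "z - h *\<^sub>R w \<in> strict_polar V"
      using e(2)[of h] e(2)[of "- h"] e(1) h by auto
    have "support_fun K ((1 - 1/2) *\<^sub>R (z - h *\<^sub>R w) + (1/2) *\<^sub>R (z + h *\<^sub>R w))
        \<le> (1 - 1/2) * support_fun K (z - h *\<^sub>R w) + 1/2 * support_fun K (z + h *\<^sub>R w)"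
      by (rule convex_onD[OF convex_on_support_fun[OF K]]) (use in_polar in auto)
    moreover have "(1 - 1/2) *\<^sub>R (z - h *\<^sub>R w) + (1/2) *\<^sub>R (z + h *\<^sub>R w) = z"
      by (simp add: algebra_simps flip: scaleR_add_left)
    ultimately show ?thesis
      using g[of 0] g[of h] g[of "- h"] e(1) h by (simp add: inner_add_right inner_diff_right)
  qed
  then show ?thesis using e(1) by (intro exI[of _ "e / 2"]) auto
qed

text \<open>The vector \<open>m = c - p\<close> is a subgradient, at the generic direction \<open>x\<close>, of
  \<open>g = h C - h A = h D - h B\<close>, where \<open>h\<close> denotes the support function. The claim amounts to
  \<open>m \<bullet> y \<le> g y\<close> for generic \<open>y\<close>. Along the segment from \<open>x\<close> to \<open>y\<close> the function \<open>g - m\<close> starts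
  at \<open>0\<close>, is nonnegative at first, and is locally midpoint convex: at each point \<open>A\<close> or \<open>B\<close> has
  a unique maximal vertex, and the corresponding one of the two representations of \<open>g\<close> shows
  it.\<close>
lemma subgradient_in_minkowski_difference:
  assumes F: "finite F" "F \<noteq> {}" and G: "finite G" "G \<noteq> {}"
    and C: "C \<in> closed_convex_sets V" and D: "D \<in> closed_convex_sets V"
    and eq: "convex hull F + V + D = convex hull G + V + C"
    and no_eq: "no_equiparallel_edges (convex hull F + V) (convex hull G + V)"
    and x: "x \<in> strict_polar V" "\<And>e. e \<in> differences F \<union> differences G \<Longrightarrow> e \<bullet> x \<noteq> 0"
    and c: "c \<in> C" "support_fun C x = c \<bullet> x"
    and p: "p \<in> F" "\<And>f. f \<in> F \<Longrightarrow> f \<bullet> x \<le> p \<bullet> x"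
    and f: "f \<in> F"
  shows "c - p + f \<in> C"
proof (rule ccontr)
  assume notin: "c - p + f \<notin> C"
  define A where "A = convex hull F + V"
  define B where "B = convex hull G + V"
  have A: "A \<in> closed_convex_sets V" and B: "B \<in> closed_convex_sets V"
    unfolding A_def B_def using V_polytope_in_closed_convex_sets F G by auto
  let ?E = "differences F \<union> differences G"
  have "finite ?E" using F G by (simp add: finite_differences)
  then obtain y where y: "y \<in> strict_polar V" "support_fun C y < (c - p + f) \<bullet> y"
      "\<And>e. e \<in> codim2_span_normals ?E x \<Longrightarrow> e \<bullet> y \<noteq> 0"
    using generic_separation[OF C notin finite_codim2_span_normals, of ?E x]
      by (auto simp: codim2_span_normals_def)
  define w where "w = y - x"
  define z where "z t = x + t *\<^sub>R w" for t
  have z_polar: "z t \<in> strict_polar V" if "0 \<le> t" "t \<le> 1" for t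
  proof -
    have "(1 - t) *\<^sub>R x + t *\<^sub>R y \<in> strict_polar V"
      using that by (intro convexD[OF convex_strict_polar x(1) y(1)]) auto
    then show ?thesis by (simp add: z_def w_def algebra_simps)
  qed
  define g where "g x = support_fun C x - support_fun A x" for x
  have g_eq: "g x = support_fun D x - support_fun B x" if "x \<in> strict_polar V" for x
    using support_fun_plus[OF A D that] support_fun_plus[OF B C that] eq
      by (simp add: g_def A_def B_def)
  define \<phi> where "\<phi> t = g (z t) - (c - p) \<bullet> z t" for t
  have "f \<bullet> x < p \<bullet> x" if "f \<in> F" "f \<noteq> p" for f
  proof -
    have "f - p \<in> ?E" using that p(1) by (auto simp: differences_def)
    then show ?thesis using x(2)[of "f - p"] p(2)[OF that(1)] by (auto simp: inner_diff_left)
  qed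
  from unique_maximizer_nearby[OF F(1) this, where w = w]
  obtain d where d: "d > 0" "\<And>h f. \<bar>h\<bar> < d \<Longrightarrow> f \<in> F \<Longrightarrow> f \<bullet> z h \<le> p \<bullet> z h"
    unfolding eventually_nhds_metric by (auto simp: dist_real_def z_def)
  have "0 \<le> \<phi> 1"
  proof (rule nonneg_if_locally_midpoint_convex)
    show "continuous_on {0..1} \<phi>" unfolding \<phi>_def g_def
      by (intro continuous_on_diff continuous_on_compose2[OF continuous_on_support_fun[OF C]]
          continuous_on_compose2[OF continuous_on_support_fun[OF A]])
        (use z_polar in \<open>auto simp: z_def intro!: continuous_intros\<close>)
    have "support_fun A x = p \<bullet> x" unfolding A_def using support_fun_V_polytope[OF x(1) p] .
    then show "\<phi> 0 = 0" using c by (simp add: \<phi>_def g_def z_def inner_diff_left)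
    show "0 < d" by (rule d)
    show "0 \<le> \<phi> t" if t: "0 < t" "t < d" "t \<le> 1" for t
    proof -
      have "support_fun A (z t) = p \<bullet> z t" unfolding A_def
        using t d(2)[of t] by (intro support_fun_V_polytope z_polar p(1)) auto
      moreover have "c \<bullet> z t \<le> support_fun C (z t)"
        using t c by (intro inner_le_support_fun[OF C] z_polar) auto
      ultimately show ?thesis by (simp add: \<phi>_def g_def inner_diff_left)
    qed
    show "\<exists>e>0. \<forall>h. 0 \<le> h \<longrightarrow> h \<le> e \<longrightarrow> 2 * \<phi> t \<le> \<phi> (t - h) + \<phi> (t + h)" if t: "0 < t" "t < 1" for t
    proof -
      have zt: "z t \<in> strict_polar V" using z_polar t by simp
      have z_shift: "z (t - h) = z t - h *\<^sub>R w" "z (t + h) = z t + h *\<^sub>R w" for h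
        by (simp_all add: z_def algebra_simps)
      have lin: "(c - p) \<bullet> z (t - h) + (c - p) \<bullet> z (t + h) = 2 * ((c - p) \<bullet> z t)" for h
        unfolding z_shift by (simp add: inner_add_right inner_diff_right)
      have "\<exists>r. e = r *\<^sub>R f" if "e \<in> ?E" "f \<in> ?E" "e \<bullet> z t = 0" "f \<bullet> z t = 0" for e f
        using parallel_if_common_wall[OF x(2) y(3) that(1,2)] that(3,4)
          unfolding z_def w_def by blast
      then consider p' where "p' \<in> F" "\<And>f. f \<in> F \<Longrightarrow> f \<noteq> p' \<Longrightarrow> f \<bullet> z t < p' \<bullet> z t"
        | q where "q \<in> G" "\<And>f. f \<in> G \<Longrightarrow> f \<noteq> q \<Longrightarrow> f \<bullet> z t < q \<bullet> z t"
        using unique_maximizer_if_no_equiparallel_edges[OF F G no_eq zt] by metis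
      then obtain e where e: "e > 0"
          "\<And>h. 0 \<le> h \<Longrightarrow> h \<le> e \<Longrightarrow> h \<le> min t (1 - t) \<Longrightarrow> 2 * g (z t) \<le> g (z (t - h)) + g (z (t + h))"
      proof cases
        case 1
        show ?thesis using support_fun_diff_midpoint_convex[OF F(1) 1 C zt, of w] that
          unfolding g_def z_shift A_def by blast
      next
        case 2
        obtain e where e: "e > 0"
            "\<And>h. 0 \<le> h \<Longrightarrow> h \<le> e \<Longrightarrow> 2 * (support_fun D (z t) - support_fun B (z t)) \<le>
            (support_fun D (z (t - h)) - support_fun B (z (t - h))) + (support_fun D (z (t + h)) -
                support_fun B (z (t + h)))"
          using support_fun_diff_midpoint_convex[OF G(1) 2 D zt, of w]
            unfolding z_shift B_def by blast
        show ?thesis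
        proof (rule that[OF e(1)])
          fix h assume h: "0 \<le> h" "h \<le> e" "h \<le> min t (1 - t)"
          then have "z (t - h) \<in> strict_polar V" "z (t + h) \<in> strict_polar V"
            using t by (auto intro!: z_polar)
          then show "2 * g (z t) \<le> g (z (t - h)) + g (z (t + h))"
            using e(2)[OF h(1,2)] g_eq zt by simp
        qed
      qed
      have "2 * \<phi> t \<le> \<phi> (t - h) + \<phi> (t + h)" if "0 \<le> h" "h \<le> min e (min t (1 - t))" for h
        using e(2)[of h] that lin[of h] by (simp add: \<phi>_def)
      moreover have "min e (min t (1 - t)) > 0" using e t by simp
      ultimately show ?thesis by blast
    qed
  qed
  then have "support_fun A y + (c - p) \<bullet> y \<le> support_fun C y" by (simp add: \<phi>_def g_def z_def w_def)
  moreover have "f \<bullet> y \<le> support_fun A y"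
    using inner_le_support_fun[OF A y(1), of f] set_plus_intro[OF hull_inc[OF f, of convex]
        zero_in_V] by (simp add: A_def)
  ultimately show False using y(2) by (simp add: inner_add_left)
qed

section \<open>The common summand\<close>

lemma plus_eq_cancel:
  assumes "A \<in> closed_convex_sets V" "X \<in> closed_convex_sets V" "Y \<in> closed_convex_sets V"
      "A + X = A + Y"
  shows "X = Y"
  using plus_subset_cancel[OF assms(1,3), of X] plus_subset_cancel[OF assms(1,2), of Y] assms(4)
    by simp

text \<open>The Minkowski difference of \<open>C\<close> and \<open>A\<close> is an intersection of translates of \<open>C\<close>.\<close>
lemma minkowski_difference_in_closed_convex_sets:
  assumes C: "C \<in> closed_convex_sets V" and A: "A \<noteq> {}" and ne: "{m. \<forall>a\<in>A. m + a \<in> C} \<noteq> {}"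
  shows "{m. \<forall>a\<in>A. m + a \<in> C} \<in> closed_convex_sets V"
proof -
  note C' = closed_convex_setsD[OF C]
  let ?M = "{m. \<forall>a\<in>A. m + a \<in> C}"
  have "?M = (\<Inter>a\<in>A. (\<lambda>m. m + a) -` C)" by auto
  moreover have "closed (\<Inter>a\<in>A. (\<lambda>m. m + a) -` C)"
    using C' by (intro closed_INT ballI closed_vimage) (auto intro!: continuous_intros)
  ultimately have "closed ?M" by simp
  moreover have "convex ?M"
  proof (rule convexI)
    fix x y and s t :: real
    assume *: "x \<in> ?M" "y \<in> ?M" "0 \<le> s" "0 \<le> t" "s + t = 1"
    have "s *\<^sub>R x + t *\<^sub>R y + a \<in> C" if "a \<in> A" for a
    proof -
      have "s *\<^sub>R (x + a) + t *\<^sub>R (y + a) \<in> C" using * that by (intro convexD[OF C'(3)]) auto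
      moreover have "s *\<^sub>R (x + a) + t *\<^sub>R (y + a) = s *\<^sub>R x + t *\<^sub>R y + (s + t) *\<^sub>R a"
        by (simp add: algebra_simps)
      ultimately show ?thesis using *(5) by simp
    qed
    then show "s *\<^sub>R x + t *\<^sub>R y \<in> ?M" by simp
  qed
  moreover have "recession_cone ?M = V"
  proof
    show "V \<subseteq> recession_cone ?M"
      using add_V_in[OF C] by (auto simp: recession_cone_def add.assoc) (metis add.commute)
    show "recession_cone ?M \<subseteq> V"
    proof
      fix v assume v: "v \<in> recession_cone ?M"
      obtain m a where ma: "m \<in> ?M" "a \<in> A" using ne A by blast
      have "v \<in> recession_cone C"
      proof (rule recession_cone_approx[OF C'(2,3), where b = "norm (m + a)"])
        show "m + real n *\<^sub>R v + a \<in> C"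
          for n using recession_cone_add_multiple[OF v ma(1), of n] ma(2) by blast
        show "norm (m + real n *\<^sub>R v + a - real n *\<^sub>R v) \<le> norm (m + a)"
          for n by (simp add: algebra_simps)
      qed
      then show "v \<in> V" using C' by simp
    qed
  qed
  ultimately show ?thesis using ne by (simp add: closed_convex_sets_def)
qed

text \<open>The cone is absorbed by \<open>M\<close>, which leaves the sum of a compact set and \<open>M\<close>.\<close>
lemma V_polytope_plus_in_closed_convex_sets:
  assumes "finite F" "F \<noteq> {}" "M \<in> closed_convex_sets V"
  shows "convex hull F + V + M \<in> closed_convex_sets V"
proof -
  have "convex hull F + V + M = convex hull F + M"
    using plus_V[OF assms(3)] by (metis add.assoc add.commute)
  then show ?thesis using assms
    by (simp add: compact_plus_in_closed_convex_sets finite_imp_compact_convex_hull)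
qed

text \<open>The common summand is the Minkowski difference \<open>M\<close> of \<open>C\<close> and \<open>A\<close>. A point of \<open>C\<close> outside
  \<open>A + M\<close> could be separated by a generic direction \<open>x\<close>; but with the maximiser \<open>c\<close> of \<open>C\<close> and
  the maximal vertex \<open>p\<close> of \<open>A\<close> in this direction, \<open>c = p + (c - p)\<close> lies in \<open>A + M\<close>. The
  equation \<open>D = B + M\<close> then follows by cancellation.\<close>
lemma common_summand_if_no_equiparallel_edges:
  assumes F: "finite F" "F \<noteq> {}" and G: "finite G" "G \<noteq> {}"
    and A_def: "A = convex hull F + V" and B_def: "B = convex hull G + V"
    and C: "C \<in> closed_convex_sets V" and D: "D \<in> closed_convex_sets V"
    and eq: "A + D = B + C" and no_eq: "no_equiparallel_edges A B"
  shows "\<exists>M\<in>closed_convex_sets V. C = A + M \<and> D = B + M"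
proof -
  let ?E = "differences F \<union> differences G"
  have E: "finite ?E" "0 \<notin> ?E" using F G by (auto simp: finite_differences zero_notin_differences)
  have A: "A \<in> closed_convex_sets V"
    unfolding A_def using V_polytope_in_closed_convex_sets F by auto
  define M where "M = {m. \<forall>a\<in>A. m + a \<in> C}"
  have subgradient: "c - p \<in> M"
    if x: "x \<in> strict_polar V" "\<forall>e\<in>?E. e \<bullet> x \<noteq> 0" and c: "c \<in> C" "support_fun C x = c \<bullet> x"
      and p: "p \<in> F" "\<And>f. f \<in> F \<Longrightarrow> f \<bullet> x \<le> p \<bullet> x" for x c p
  proof -
    have "f \<in> (\<lambda>y. c - p + y) -` C" if "f \<in> F" for f
      using subgradient_in_minkowski_difference[OF F G C D eq[unfolded A_def B_def] no_eq[unfolded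
          A_def B_def] x(1) _ c p that] x(2)
      by auto
    moreover have "convex ((\<lambda>y. c - p + y) -` C)"
    proof -
      have "(\<lambda>y. c - p + y) -` C = (+) (- (c - p)) ` C"
        by (auto simp: image_iff intro!: bexI[of _ "c - p + _"])
      then show ?thesis using convex_translation closed_convex_setsD(3)[OF C] by metis
    qed
    ultimately have hull: "convex hull F \<subseteq> (\<lambda>y. c - p + y) -` C" by (intro hull_minimal) auto
    have "c - p + a \<in> C" if a: "a \<in> A" for a
    proof -
      obtain q v where "a = q + v" "q \<in> convex hull F" "v \<in> V"
        using a unfolding A_def by (rule set_plus_elim)
      then show ?thesis using add_V_in[OF C, of "c - p + q" v] hull by (auto simp: add.assoc)
    qed
    then show ?thesis by (simp add: M_def)
  qed
  have "M \<noteq> {}"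
  proof -
    obtain x where x: "x \<in> strict_polar V" "\<forall>e\<in>?E. e \<bullet> x \<noteq> 0"
      using avoid_hyperplanes[OF E open_strict_polar strict_polar_nonempty] by blast
    obtain p where p: "p \<in> F" "\<And>f. f \<in> F \<Longrightarrow> f \<bullet> x \<le> p \<bullet> x"
      using finite_attains_inner[OF F, of x] by blast
    obtain c where c: "c \<in> C" "support_fun C x = c \<bullet> x" using support_fun_attained[OF C x(1)] .
    show ?thesis using subgradient[OF x c p] by blast
  qed
  then have M: "M \<in> closed_convex_sets V"
    unfolding M_def using minkowski_difference_in_closed_convex_sets[OF C] closed_convex_setsD(1)[OF
        A] by blast
  have AM: "A + M \<in> closed_convex_sets V" and BM: "B + M \<in> closed_convex_sets V"
    unfolding A_def B_def using V_polytope_plus_in_closed_convex_sets M F G by auto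
  have "A + M \<subseteq> C" by (auto simp: set_plus_def M_def add.commute)
  moreover have "C \<subseteq> A + M"
  proof
    fix k assume k: "k \<in> C"
    show "k \<in> A + M"
    proof (rule ccontr)
      assume "k \<notin> A + M"
      then obtain x where x: "x \<in> strict_polar V" "support_fun (A + M) x < k \<bullet> x" "\<forall>e\<in>?E. e \<bullet> x \<noteq> 0"
        using generic_separation[OF AM _ E] by blast
      obtain p where p: "p \<in> F" "\<And>f. f \<in> F \<Longrightarrow> f \<bullet> x \<le> p \<bullet> x"
        using finite_attains_inner[OF F, of x] by blast
      obtain c where c: "c \<in> C" "support_fun C x = c \<bullet> x" using support_fun_attained[OF C x(1)] .
      have "p \<in> A" using set_plus_intro[OF hull_inc[OF p(1), of convex] zero_in_V]
        by (simp add: A_def)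
      then have "p + (c - p) \<in> A + M" using subgradient[OF x(1,3) c p] by (rule set_plus_intro)
      then have "c \<bullet> x \<le> support_fun (A + M) x" using inner_le_support_fun[OF AM x(1)] by simp
      then show False using x(2) inner_le_support_fun[OF C x(1) k] c by simp
    qed
  qed
  ultimately have CAM: "C = A + M" by simp
  have "A + D = A + (B + M)" using eq CAM by (simp add: ac_simps)
  then have "D = B + M" using plus_eq_cancel[OF A D BM] by simp
  then show ?thesis using M CAM by blast
qed

section \<open>Exchanging equiparallel edges\<close>

text \<open>With \<open>J\<close> a shortened edge of the polytope with vertices \<open>F\<close>, this set replaces that edge
  by \<open>J\<close>: the elements of \<open>S\<close> push the polytope strictly below \<open>J\<close> in the outer normal direction
  that defines the edge, but for directions \<open>x\<close> in which some \<open>s\<close> satisfies \<open>0 \<le> s \<bullet> x\<close> the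
  translates by \<open>S\<close> still reach at least as far as the polytope. For an empty \<open>S\<close> it is just
  \<open>J + V\<close>.\<close>
definition exchange_set :: "'a set \<Rightarrow> 'a set \<Rightarrow> 'a set \<Rightarrow> 'a set" where
  "exchange_set J F S = convex hull (J \<union> (F + S)) + V"

lemma exchange_set_in_closed_convex_sets:
  assumes "compact J" "J \<noteq> {}" "finite F" "finite S"
  shows "exchange_set J F S \<in> closed_convex_sets V"
proof -
  have "compact (J \<union> (F + S))"
    using assms by (intro compact_Un finite_imp_compact[OF finite_set_plus])
  then show ?thesis unfolding exchange_set_def using assms(2)
    by (intro compact_plus_V_in_closed_convex_sets compact_convex_hull) auto
qed

text \<open>The only sums of generators that are not obviously on the right are \<open>f + i\<close> with \<open>i\<close> in
  \<open>JB\<close>. A direction \<open>x\<close> separating such a sum must be negative on all of \<open>S\<close>, since otherwise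
  \<open>i + (f + s)\<close> reaches at least as far. For the remaining directions the assumption \<open>cut\<close>
  provides an element of the right-hand side that reaches at least as far.\<close>
lemma exchange_subset:
  assumes F: "finite F" "F \<noteq> {}" and G: "finite G" "G \<noteq> {}" and S: "finite S"
    and JA: "compact JA" "JA \<noteq> {}" and JB: "JB \<subseteq> convex hull G + V"
    and cut: "\<And>x f i. f \<in> F \<Longrightarrow> i \<in> JB \<Longrightarrow> \<forall>s\<in>S. s \<bullet> x < 0 \<Longrightarrow> \<exists>g\<in>convex hull G + V. \<exists>j\<in>JA. (f + i) \<bullet> x \<le>
        (g + j) \<bullet> x"
  shows "convex hull F + V + exchange_set JB G S \<subseteq> convex hull G + V + exchange_set JA F S"
proof -
  define B where "B = convex hull G + V"
  define C where "C = exchange_set JA F S"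
  have C: "C \<in> closed_convex_sets V"
    unfolding C_def using exchange_set_in_closed_convex_sets F(1) S JA by blast
  then have BC: "B + C \<in> closed_convex_sets V"
    unfolding B_def using V_polytope_plus_in_closed_convex_sets G by blast
  note BC' = closed_convex_setsD[OF BC]
  have C_gen: "y \<in> C" if "y \<in> JA \<union> (F + S)" for y
    using set_plus_intro[OF hull_inc[OF that, of convex] zero_in_V]
      by (simp add: C_def exchange_set_def)
  have B_gen: "y \<in> B" if "y \<in> G" for y
    using set_plus_intro[OF hull_inc[OF that, of convex] zero_in_V] by (simp add: B_def)
  have "f + i \<in> B + C" if f: "f \<in> F" and i: "i \<in> JB \<union> (G + S)" for f i
  proof (cases "i \<in> JB")
    case False
    then obtain g s where "i = g + s" "g \<in> G" "s \<in> S" using i by (auto simp: set_plus_def)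
    then have "g + (f + s) \<in> B + C" using f by (intro set_plus_intro B_gen C_gen) auto
    then show ?thesis using \<open>i = g + s\<close> by (simp add: ac_simps)
  next
    case True
    show ?thesis
    proof (rule ccontr)
      assume "f + i \<notin> B + C"
      then obtain x where x: "x \<in> strict_polar V" "support_fun (B + C) x < (f + i) \<bullet> x"
        using separation[OF BC] by blast
      have less: "y \<bullet> x < (f + i) \<bullet> x" if "y \<in> B + C" for y
        using inner_le_support_fun[OF BC x(1) that] x(2) by simp
      show False
      proof (cases "\<forall>s\<in>S. s \<bullet> x < 0")
        case True
        then obtain g j where "g \<in> B" "j \<in> JA" "(f + i) \<bullet> x \<le> (g + j) \<bullet> x"
          using cut[OF f \<open>i \<in> JB\<close> True] unfolding B_def by blast
        then show False using less[OF set_plus_intro[OF _ C_gen]] by fastforce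
      next
        case False
        then obtain s where s: "s \<in> S" "0 \<le> s \<bullet> x" by force
        have "i + (f + s) \<in> B + C"
          using True JB s f by (intro set_plus_intro C_gen) (auto simp: B_def)
        then show False using less[of "i + (f + s)"] s by (simp add: inner_add_left)
      qed
    qed
  qed
  then have "F + (JB \<union> (G + S)) \<subseteq> B + C" by (blast elim: set_plus_elim)
  then have "convex hull (F + (JB \<union> (G + S))) \<subseteq> B + C" using BC' by (intro hull_minimal)
  then have "convex hull (F + (JB \<union> (G + S))) + (V + V) \<subseteq> B + C + (V + V)"
    by (rule set_plus_mono2) simp
  also have "\<dots> = B + C" using plus_V[OF BC] by (simp flip: add.assoc)
  finally have "convex hull F + convex hull (JB \<union> (G + S)) + (V + V) \<subseteq> B + C"
    by (simp add: convex_hull_set_plus)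
  moreover have "convex hull F + V + exchange_set JB G S = convex hull F + convex hull (JB \<union>
      (G + S)) + (V + V)"
    unfolding exchange_set_def by (simp only: ac_simps)
  ultimately show ?thesis unfolding B_def C_def by simp
qed

end

lemma closed_segment_direction:
  fixes a w :: "'a::real_vector"
  assumes "0 \<le> k"
  shows "closed_segment a (a + k *\<^sub>R w) = (\<lambda>t. a + t *\<^sub>R w) ` {0..k}"
proof -
  have "closed_segment a (a + k *\<^sub>R w) = (\<lambda>t. a + t *\<^sub>R w) ` closed_segment 0 k"
  proof -
    have "(1 - r) *\<^sub>R a + r *\<^sub>R (a + k *\<^sub>R w) = a + ((1 - r) * 0 + r * k) *\<^sub>R w" for r
      by (simp add: algebra_simps)
    then show ?thesis by (force simp: closed_segment_def image_iff)
  qed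
  then show ?thesis using assms by (simp add: closed_segment_eq_real_ivl)
qed

lemma closed_segment_directionE:
  fixes a w :: "'a::real_vector"
  assumes "y \<in> closed_segment a (a + k *\<^sub>R w)" "0 \<le> k"
  obtains t where "y = a + t *\<^sub>R w" "0 \<le> t" "t \<le> k"
  using assms(1) unfolding closed_segment_direction[OF assms(2)] image_iff Bex_def atLeastAtMost_iff
    by blast

context pointed_closed_cone
begin

text \<open>An element of \<open>V\<close> on which \<open>u\<close> vanishes would span a ray in the support set, one on which
  \<open>u\<close> is positive would contradict maximality.\<close>
lemma strict_polar_if_bounded_support_set:
  assumes A: "A \<in> closed_convex_sets V" and bdd: "bounded (support_set A u)"
      and ne: "support_set A u \<noteq> {}"
  shows "u \<in> strict_polar V"
proof -
  obtain a where a: "a \<in> support_set A u" using ne by blast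
  then have aA: "a \<in> A" "\<And>y. y \<in> A \<Longrightarrow> y \<bullet> u \<le> a \<bullet> u" by (auto simp: support_set_def)
  obtain b where b: "\<And>y. y \<in> support_set A u \<Longrightarrow> norm y \<le> b" using bdd bounded_iff by metis
  have "v \<bullet> u < 0" if v: "v \<in> V" "v \<noteq> 0" for v
  proof (rule ccontr)
    assume neg: "\<not> v \<bullet> u < 0"
    have shift: "a + t *\<^sub>R v \<in> A"
      if "0 \<le> t" for t using add_V_in[OF A aA(1) scale_in_V[OF v(1) that]] .
    have "v \<bullet> u \<le> 0" using aA(2)[OF shift[of 1]] by (simp add: inner_add_left)
    then have "v \<bullet> u = 0" using neg by simp
    then have "a + t *\<^sub>R v \<in> support_set A u" if "0 \<le> t" for t
      using shift[OF that] aA by (auto simp: support_set_def inner_add_left)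
    then have *: "norm (a + t *\<^sub>R v) \<le> b" if "0 \<le> t" for t using b that by blast
    define t where "t = (b + norm a + 1) / norm v"
    have "0 \<le> b" using b[OF a] norm_ge_zero order_trans by blast
    then have "0 \<le> t" by (simp add: t_def)
    have "norm (t *\<^sub>R v) \<le> norm (a + t *\<^sub>R v) + norm a"
      by (metis add_diff_cancel_left' norm_triangle_ineq4)
    moreover have "norm (t *\<^sub>R v) = b + norm a + 1" using v(2) \<open>0 \<le> b\<close> by (simp add: t_def)
    ultimately show False using *[OF \<open>0 \<le> t\<close>] by linarith
  qed
  then show ?thesis by (simp add: strict_polar_def)
qed

text \<open>In direction \<open>x\<close> the vertex \<open>f\<close> does not exceed the edge of \<open>A\<close> at \<open>u\<close>. Removing the
  length \<open>s\<close> from the second edge instead of the first leaves the sum of the two edges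
  unchanged, and one of the ends of this sum maximises \<open>x\<close>.\<close>
lemma exchange_cut:
  assumes A: "A \<in> closed_convex_sets V" "F \<subseteq> A"
    and Au: "support_set A u = closed_segment a (a + \<alpha> *\<^sub>R w)"
        and Bu: "support_set B u = closed_segment c (c + \<beta> *\<^sub>R w)"
    and s: "0 \<le> s" "s \<le> \<alpha>" "s \<le> \<beta>"
    and f: "f \<in> F" and i: "i \<in> closed_segment c (c + (\<beta> - s) *\<^sub>R w)"
    and x: "f \<bullet> u < a \<bullet> u \<Longrightarrow> (f - a) \<bullet> x < 0"
  shows "\<exists>g\<in>B. \<exists>j\<in>closed_segment a (a + (\<alpha> - s) *\<^sub>R w). (f + i) \<bullet> x \<le> (g + j) \<bullet> x"
proof -
  have "c \<in> support_set B u" "c + \<beta> *\<^sub>R w \<in> support_set B u" unfolding Bu by auto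
  then have cB: "c \<in> B" "c + \<beta> *\<^sub>R w \<in> B" by (simp_all add: support_set_def)
  have "a \<in> support_set A u" unfolding Au by auto
  then have aA: "a \<in> A" "\<And>y. y \<in> A \<Longrightarrow> y \<bullet> u \<le> a \<bullet> u" by (auto simp: support_set_def)
  obtain r where r: "i = c + r *\<^sub>R w" "0 \<le> r" "r \<le> \<beta> - s"
    using closed_segment_directionE[OF i] s by auto
  obtain l where l: "f \<bullet> x \<le> a \<bullet> x + l * (w \<bullet> x)" "0 \<le> l" "l \<le> \<alpha>"
  proof (cases "f \<bullet> u < a \<bullet> u")
    case True
    then show ?thesis using x that[of 0] s by (simp add: inner_diff_left)
  next
    case False
    have "f \<in> A" using f A by blast
    then have "f \<in> support_set A u" using False aA by (force simp: support_set_def)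
    then obtain l where "f = a + l *\<^sub>R w" "0 \<le> l" "l \<le> \<alpha>"
      using closed_segment_directionE[of f a \<alpha> w] Au s by auto
    then show ?thesis using that[of l] by (simp add: inner_add_left)
  qed
  have bound: "(f + i) \<bullet> x \<le> a \<bullet> x + c \<bullet> x + (l + r) * (w \<bullet> x)"
    using l r by (simp add: inner_add_left algebra_simps)
  show ?thesis
  proof (cases "w \<bullet> x \<le> 0")
    case True
    then have "(l + r) * (w \<bullet> x) \<le> 0" using l r by (simp add: mult_nonneg_nonpos)
    then have "(f + i) \<bullet> x \<le> (c + a) \<bullet> x" using bound by (simp add: inner_add_left)
    then show ?thesis using cB(1) by (intro bexI[of _ c] bexI[of _ a]) auto
  next
    case False
    then have "(l + r) * (w \<bullet> x) \<le> (\<beta> + (\<alpha> - s)) * (w \<bullet> x)"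
      using l r by (intro mult_right_mono) auto
    then have "(f + i) \<bullet> x \<le> ((c + \<beta> *\<^sub>R w) + (a + (\<alpha> - s) *\<^sub>R w)) \<bullet> x"
      using bound by (simp add: inner_add_left algebra_simps)
    then show ?thesis using cB(2)
      by (intro bexI[of _ "c + \<beta> *\<^sub>R w"] bexI[of _ "a + (\<alpha> - s) *\<^sub>R w"]) auto
  qed
qed

text \<open>Faces of a Minkowski sum contain translates of the faces of its summands, so the edge of a
  sum cannot be shorter than that of a summand.\<close>
lemma not_summand_if_shorter_edge:
  assumes Au: "a \<in> support_set A u" "a + \<alpha> *\<^sub>R w \<in> support_set A u"
    and Cu: "support_set C u = closed_segment a (a + k *\<^sub>R w)"
    and k: "0 \<le> k" "k < \<alpha>" and w: "w \<noteq> 0"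
  shows "C \<noteq> A + M"
proof
  assume C: "C = A + M"
  have "a \<in> support_set C u" unfolding Cu by simp
  then have aC: "a \<in> C" "\<And>y. y \<in> C \<Longrightarrow> y \<bullet> u \<le> a \<bullet> u" by (auto simp: support_set_def)
  obtain a' m where a': "a = a' + m" "a' \<in> A" "m \<in> M" using aC(1) C by (auto simp: set_plus_def)
  have "y + m \<in> support_set C u" if y: "y \<in> support_set A u" for y
  proof -
    have "y + m \<in> C" using y a' by (auto simp: C support_set_def)
    moreover have "a \<bullet> u \<le> (y + m) \<bullet> u" using y a' by (auto simp: support_set_def inner_add_left)
    ultimately show ?thesis using aC(2) order_trans unfolding support_set_def by blast
  qed
  note shift = this[unfolded Cu]
  obtain l1 where l1: "a + m = a + l1 *\<^sub>R w" "0 \<le> l1"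
    using closed_segment_directionE[OF shift[OF Au(1)] k(1)] .
  obtain l2 where l2: "a + \<alpha> *\<^sub>R w + m = a + l2 *\<^sub>R w" "l2 \<le> k"
    using closed_segment_directionE[OF shift[OF Au(2)] k(1)] .
  have "(\<alpha> + l1) *\<^sub>R w = l2 *\<^sub>R w" using l1(1) l2(1) by (simp add: scaleR_add_left add.assoc)
  then have "\<alpha> + l1 = l2" using w by simp
  then show False using l1 l2 k by linarith
qed

text \<open>The vectors in \<open>S\<close> lead from an end of the edge to the vertices strictly below it. In
  directions that are negative on all of them, the vertices off the edge stay below that end.
  Both edges are shortened by the length of the shorter one, which may become a point.\<close>
lemma exists_non_summand_if_codirected_edges:
  assumes F: "finite F" "F \<noteq> {}" and G: "finite G" "G \<noteq> {}"
    and A_def: "A = convex hull F + V" and B_def: "B = convex hull G + V"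
    and Au: "support_set A u = closed_segment a (a + \<alpha> *\<^sub>R w)"
        and Bu: "support_set B u = closed_segment c (c + \<beta> *\<^sub>R w)"
    and pos: "0 < \<alpha>" "0 < \<beta>" "w \<noteq> 0"
  shows "\<exists>C\<in>closed_convex_sets V. \<exists>D\<in>closed_convex_sets V. A + D = B + C \<and> (\<forall>M. C \<noteq> A + M)"
proof -
  define s where "s = min \<alpha> \<beta>"
  have s: "0 < s" "s \<le> \<alpha>" "s \<le> \<beta>" using pos by (auto simp: s_def)
  define JA where "JA = closed_segment a (a + (\<alpha> - s) *\<^sub>R w)"
  define JB where "JB = closed_segment c (c + (\<beta> - s) *\<^sub>R w)"
  define S where "S = (\<lambda>f. f - a) ` {f \<in> F. f \<bullet> u < a \<bullet> u} \<union> (\<lambda>g. g - c) ` {g \<in> G. g \<bullet> u < c \<bullet> u}"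
  have S: "finite S" using F G by (simp add: S_def)
  have A: "A \<in> closed_convex_sets V" and B: "B \<in> closed_convex_sets V"
    unfolding A_def B_def using V_polytope_in_closed_convex_sets F G by auto
  have FA: "F \<subseteq> A" and GB: "G \<subseteq> B"
    unfolding A_def B_def using set_plus_intro[OF hull_inc[of _ _ convex] zero_in_V] by force+
  have JA_sub: "JA \<subseteq> support_set A u" and JB_sub: "JB \<subseteq> support_set B u"
    unfolding Au Bu JA_def JB_def using s by (auto simp: closed_segment_direction)
  have JA: "compact JA" "convex JA" "JA \<noteq> {}" and JB: "compact JB" "convex JB" "JB \<noteq> {}"
    by (simp_all add: JA_def JB_def)
  have C: "exchange_set JA F S \<in> closed_convex_sets V"
      and D: "exchange_set JB G S \<in> closed_convex_sets V"
    using exchange_set_in_closed_convex_sets JA JB F G S by auto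
  have "A + exchange_set JB G S \<subseteq> B + exchange_set JA F S"
    unfolding A_def B_def
  proof (rule exchange_subset[OF F G S JA(1,3)])
    show "JB \<subseteq> convex hull G + V" using JB_sub B_def by (auto simp: support_set_def)
    fix x f i assume *: "f \<in> F" "i \<in> JB" "\<forall>s\<in>S. s \<bullet> x < 0"
    show "\<exists>g\<in>convex hull G + V. \<exists>j\<in>JA. (f + i) \<bullet> x \<le> (g + j) \<bullet> x"
      unfolding B_def[symmetric] JA_def
      by (rule exchange_cut[OF A FA Au Bu _ s(2,3) *(1) *(2)[unfolded JB_def]]) (use s * in
          \<open>auto simp: S_def\<close>)
  qed
  moreover have "B + exchange_set JA F S \<subseteq> A + exchange_set JB G S"
    unfolding A_def B_def
  proof (rule exchange_subset[OF G F S JB(1,3)])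
    show "JA \<subseteq> convex hull F + V" using JA_sub A_def by (auto simp: support_set_def)
    fix x f i assume *: "f \<in> G" "i \<in> JA" "\<forall>s\<in>S. s \<bullet> x < 0"
    show "\<exists>g\<in>convex hull F + V. \<exists>j\<in>JB. (f + i) \<bullet> x \<le> (g + j) \<bullet> x"
      unfolding A_def[symmetric] JB_def
      by (rule exchange_cut[OF B GB Bu Au _ s(3,2) *(1) *(2)[unfolded JA_def]]) (use s * in
          \<open>auto simp: S_def\<close>)
  qed
  moreover have "exchange_set JA F S \<noteq> A + M" for M
  proof (rule not_summand_if_shorter_edge[where u = u])
    show "a \<in> support_set A u" "a + \<alpha> *\<^sub>R w \<in> support_set A u" unfolding Au by auto
    then have top: "y \<bullet> u \<le> a \<bullet> u" if "y \<in> A" for y using that by (auto simp: support_set_def)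
    have "c \<in> support_set B u" unfolding Bu by simp
    then have neg: "s \<bullet> u < 0" if "s \<in> S" for s using that by (auto simp: S_def inner_diff_left)
    have u: "u \<in> strict_polar V"
      by (rule strict_polar_if_bounded_support_set[OF A]) (simp_all add: Au bounded_closed_segment)
    have "support_set (exchange_set JA F S) u = JA" unfolding exchange_set_def
    proof (rule support_set_hull_plus_V[OF u JA(2,3), where b = "a \<bullet> u"])
      show "y \<bullet> u = a \<bullet> u" if "y \<in> JA" for y
        using JA_sub that \<open>a \<in> support_set A u\<close> by (auto simp: support_set_def intro: antisym)
      show "y \<bullet> u < a \<bullet> u" if y: "y \<in> F + S" for y
      proof -
        obtain f s where "y = f + s" "f \<in> F" "s \<in> S" using y by (rule set_plus_elim)
        then show ?thesis using top[of f] neg[of s] FA by (auto simp: inner_add_left)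
      qed
    qed
    then show "support_set (exchange_set JA F S) u = closed_segment a (a + (\<alpha> - s) *\<^sub>R w)"
      by (simp add: JA_def)
  qed (use s pos in auto)
  ultimately show ?thesis using C D by blast
qed

text \<open>Interchanging the ends of the second edge if necessary makes the two edges point the same
  way.\<close>
lemma exists_non_summand_if_equiparallel_edges:
  assumes F: "finite F" "F \<noteq> {}" and G: "finite G" "G \<noteq> {}"
    and A_def: "A = convex hull F + V" and B_def: "B = convex hull G + V"
    and edges: "equiparallel_edges_at A B u"
  shows "\<exists>C\<in>closed_convex_sets V. \<exists>D\<in>closed_convex_sets V. A + D = B + C \<and> (\<forall>M. C \<noteq> A + M)"
proof -
  obtain a b c d t where *: "a \<noteq> b" "c \<noteq> d" "support_set A u = closed_segment a b"
      "support_set B u = closed_segment c d" "d - c = t *\<^sub>R (b - a)"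
    using edges unfolding equiparallel_edges_at_def parallel_segments_def by blast
  define w where "w = b - a"
  have w: "w \<noteq> 0" "b = a + 1 *\<^sub>R w" using * by (auto simp: w_def)
  note exchange = exists_non_summand_if_codirected_edges[OF F G A_def B_def *(3)[unfolded w(2)]]
  have d: "d = c + t *\<^sub>R w" using *(5) by (simp add: w_def algebra_simps)
  have "t \<noteq> 0" using * by auto
  then consider "0 < t" | "0 < - t" by linarith
  then show ?thesis
  proof cases
    case 1
    show ?thesis by (rule exchange[of c t]) (use 1 w * d in auto)
  next
    case 2
    have "c = d + (- t) *\<^sub>R w" using d by simp
    then have "support_set B u = closed_segment d (d + (- t) *\<^sub>R w)"
      using *(4) by (simp add: closed_segment_commute)
    from exchange[OF this _ 2 w(1)] show ?thesis by simp
  qed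
qed

end

section \<open>Reduced pairs of polytopes\<close>

lemma V_polytopeE:
  assumes "A \<in> V_polytopes V"
  obtains F where "finite F" "F \<noteq> {}" "A = convex hull F + V"
proof -
  obtain P where P: "polytope P" "P \<noteq> {}" "A = P + V" using assms unfolding V_polytopes_def by blast
  then obtain F where F: "finite F" "P = convex hull F" unfolding polytope_def by blast
  then have "F \<noteq> {}" using P(2) by auto
  then show thesis using that F P(3) by blast
qed

theorem theorem5p6:
  fixes V A B :: "(real ^ 'n) set"
  assumes "closed V" and "convex V" and "cone V" and "pointed V"
    and "(A, B) \<in> V_polytopes V \<times> V_polytopes V"
  shows "reduced_pair V (A, B) \<longleftrightarrow> no_equiparallel_edges A B"
proof -
  interpret pointed_closed_cone V using assms by unfold_locales
  obtain F where F: "finite F" "F \<noteq> {}" and A_def: "A = convex hull F + V"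
    using assms(5) V_polytopeE by blast
  obtain G where G: "finite G" "G \<noteq> {}" and B_def: "B = convex hull G + V"
    using assms(5) V_polytopeE by blast
  let ?C = "closed_convex_sets V"
  have A: "A \<in> ?C" and B: "B \<in> ?C"
    unfolding A_def B_def using V_polytope_in_closed_convex_sets F G by auto
  have summand: "A + M \<in> ?C" "B + M \<in> ?C" if "M \<in> ?C" for M
    unfolding A_def B_def using V_polytope_plus_in_closed_convex_sets that F G by auto
  define X where "X = {(C, D). C \<in> ?C \<and> D \<in> ?C \<and> A + D = B + C}"
  define Y where "Y = {(A + M, B + M) | M. M \<in> ?C}"
  have "pair_equiv V `` {(A, B)} = X"
    using A B by (auto simp: pair_equiv_def X_def)
  then have "reduced_pair V (A, B) \<longleftrightarrow> X = Y"
    using A B by (simp add: reduced_pair_def flip: Y_def)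
  also have "\<dots> \<longleftrightarrow> X \<subseteq> Y"
  proof -
    have "Y \<subseteq> X" using summand by (auto simp: X_def Y_def ac_simps)
    then show ?thesis by blast
  qed
  also have "\<dots> \<longleftrightarrow> (\<forall>C\<in>?C. \<forall>D\<in>?C. A + D = B + C \<longrightarrow> (\<exists>M\<in>?C. C = A + M \<and> D = B + M))"
    unfolding X_def Y_def subset_iff split_paired_All mem_Collect_eq prod.case prod.inject by blast
  finally have reduced_iff: "reduced_pair V (A, B) \<longleftrightarrow>
      (\<forall>C\<in>?C. \<forall>D\<in>?C. A + D = B + C \<longrightarrow> (\<exists>M\<in>?C. C = A + M \<and> D = B + M))" .
  show ?thesis
  proof
    assume "reduced_pair V (A, B)"
    then have "\<not> equiparallel_edges_at A B u" for u
      using exists_non_summand_if_equiparallel_edges[OF F G A_def B_def, of u]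
        unfolding reduced_iff by blast
    then show "no_equiparallel_edges A B" by (simp add: no_equiparallel_edges_def)
  next
    assume "no_equiparallel_edges A B"
    then show "reduced_pair V (A, B)"
      unfolding reduced_iff
        using common_summand_if_no_equiparallel_edges[OF F G A_def B_def] by blast
  qed
qed

end
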